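(* Let $\delta>0$ and let $\phi_2^\delta$ be the time-$\delta$ flow map, in the flow/impact sense defined in the context, of the discontinuous Hamiltonian $H_2(q,p)=\frac12 p^Tp+V(q)$ on $\mathbb{R}^d\times\mathbb{R}^d$. Under Conditions 1 and 2 of the context, $\phi_2^\delta$ is symplectic in the reflection/refraction case (the case in which an impact occurs within the step). That is, for each of the two impact cases, reflection and refraction, let $[Q,P]=\phi_2^\delta[q,p]$ be given by the impact-case formula of the context, and let $J=\dfrac{\partial(Q,P)}{\partial(q,p)}$ be its Jacobian matrix. Then $$J^T\Omega J=\Omega,\qquad \Omega=\begin{bmatrix}0&I\\-I&0\end{bmatrix},$$ where $I$ is the $d\times d$ identity matrix.
   Context: **Potential and interfaces.** $D_1,\dots,D_M\subset\mathbb{R}^d$ are open sets whose closures form a partition of $\mathbb{R}^d$ (they cover $\mathbb{R}^d$ and the $D_i$ are pairwise disjoint). The function $V$ is piecewise constant: $V(q)=V_i$ for $q\in D_i$, with constants $V_i\in\mathbb{R}$; $V$ is undefined on the interfaces. The interfaces are $B_{ij}=\overline{D_i}\cap\overline{D_j}$ for $i\ne j$ (and $B_{ii}=\emptyset$); each is either empty or a $\mathcal{C}^1$ submanifold of $\mathbb{R}^d$ of codimension 1. **Definition of $\phi_2^\delta$.** The step size $\delta$ is small enough that there is at most one impact per step. Let $(q,p)$ be the current position and momentum, with the particle in $D_i$ (if $q$ is itself on an interface, the side $D_i$ from which the particle arrives is specified as part of the initial condition). Between impacts the particle drifts freely ("flow"): after time $s$ its position is $q+sp$ and its momentum is $p$.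 Let $\tau=\tau(q,p)$ be the time at which the drifting particle hits the interface. *No impact:* if the interface is not hit during the step ($\tau>\delta$ or $\tau<0$, or there is no hit), then $\phi_2^\delta[q,p]=[q+\delta p,\,p]$. *Impact (reflection/refraction case):* otherwise, $0\le\tau\le\delta$. Let $B_{ij}$ be the interface hit and let $q_*=q+\tau p\in B_{ij}$ be the hitting position. Let $\hat n$ be the unit normal vector of $B_{ij}$ at $q_*$ pointing from $D_i$ to $D_j$, let $p^n=(p\cdot\hat n)\hat n$ and $p^t=p-p^n$ be the normal and tangential parts of the incident momentum, and let $\Delta V=V_j-V_i$. The impact leaves the position $q_*$ unchanged and instantaneously replaces $p$ by $$p_b=\begin{cases}p^t-p^n, & \|p^n\|^2/2<\Delta V\quad\text{(reflection)},\\[2pt] p^t+\sqrt{\|p^n\|^2-2\Delta V}\;\hat n, & \|p^n\|^2/2>\Delta V\quad\text{(refraction)}.\end{cases}$$ The particle then drifts freely for the remaining time $\delta-\tau$, so that $$\phi_2^\delta[q,p]=[Q,P]=[\,q_*+(\delta-\tau)p_b,\;p_b\,].$$ **Condition 1.** In the time horizon of interest, each position at which the trajectory hits an interface belongs to only one interface (no impact occurs at an intersection of several interfaces). **Condition 2 (no sliding).** For any time $t$ in the time horizon of interest at which the position $q(t)$ lies on some interface $B_{ij}$, the momentum satisfies $p(t)\notin T_{q(t)}B_{ij}$; that is, sliding along an interface for a nonzero amount of time never happens. In particular, the borderline case $\|p^n\|^2/2=\Delta V$, the transition between reflection and refraction, does not occur. *)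

theory Defs
  imports "HOL-Analysis.Analysis"
begin

section \<open>Regions and interfaces\<close>

definition region_partition :: "(nat \<Rightarrow> (real^'n) set) \<Rightarrow> nat \<Rightarrow> bool" where
  "region_partition D M \<longleftrightarrow>
     (\<forall>i\<in>{1..M}. open (D i)) \<and> disjoint_family_on D {1..M} \<and> (\<Union>i\<in>{1..M}. closure (D i)) = UNIV"

definition interface :: "(nat \<Rightarrow> (real^'n) set) \<Rightarrow> nat \<Rightarrow> nat \<Rightarrow> (real^'n) set" where
  "interface D i j = (if i = j then {} else closure (D i) \<inter> closure (D j))"

definition interfaces :: "(nat \<Rightarrow> (real^'n) set) \<Rightarrow> nat \<Rightarrow> (real^'n) set" where
  "interfaces D M = (\<Union>i\<in>{1..M}. \<Union>j\<in>{1..M}. interface D i j)"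

text \<open>Embedded submanifolds without boundary, of class \<open>C\<^sup>1\<close> and codimension 1, as local zero sets
  of \<open>C\<^sup>1\<close> functions with nonvanishing gradient \<open>G\<close>.  The empty set qualifies.\<close>

definition C1_hypersurface :: "(real^'n) set \<Rightarrow> bool" where
  "C1_hypersurface B \<longleftrightarrow>
     (\<forall>x\<in>B. \<exists>U (g :: real^'n \<Rightarrow> real) G. open U \<and> x \<in> U \<and>
        (\<forall>y\<in>U. (g has_derivative (\<lambda>h. G y \<bullet> h)) (at y)) \<and> continuous_on U G \<and>
        (\<forall>y\<in>U. G y \<noteq> 0) \<and> B \<inter> U = {y \<in> U. g y = 0})"

definition tangent_space :: "(real^'n) set \<Rightarrow> real^'n \<Rightarrow> (real^'n) set" where
  "tangent_space B x = {v. \<exists>\<gamma> \<epsilon>. \<epsilon> > 0 \<and> \<gamma> 0 = x \<and> (\<forall>t\<in>{-\<epsilon><..<\<epsilon>}. \<gamma> t \<in> B) \<and>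
     (\<gamma> has_vector_derivative v) (at (0::real))}"

text \<open>Closures appear in \<open>unit_normal\<close> and \<open>arrives_from\<close> because a region need not be the interior
  of its closure: an open set such as a slit half-space is allowed, and a short segment leaving the
  interface may then stay on one side without staying in the region itself.\<close>

definition unit_normal :: "(nat \<Rightarrow> (real^'n) set) \<Rightarrow> nat \<Rightarrow> nat \<Rightarrow> real^'n \<Rightarrow> real^'n" where
  "unit_normal D i j x = (THE n. norm n = 1 \<and> (\<forall>v\<in>tangent_space (interface D i j) x. n \<bullet> v = 0) \<and>
     (\<exists>\<epsilon>>0. \<forall>s\<in>{0<..<\<epsilon>}. x - s *\<^sub>R n \<in> closure (D i) \<and> x + s *\<^sub>R n \<in> closure (D j)))"


section \<open>The flow/impact map\<close>

text \<open>The potential enters only through its constant values \<open>V i\<close> on the regions \<open>D i\<close>; it has no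
  value on the interfaces.

  The side \<open>i\<close> is part of the state.  It is redundant unless the particle starts on an
  interface, where it has to be the side from which the particle arrives.\<close>

definition arrives_from :: "(real^'n) set \<Rightarrow> real^'n \<Rightarrow> real^'n \<Rightarrow> bool" where
  "arrives_from A q p \<longleftrightarrow> (\<exists>\<epsilon>>0. \<forall>s\<in>{0<..<\<epsilon>}. q - s *\<^sub>R p \<in> closure A)"

definition valid_state :: "(nat \<Rightarrow> (real^'n) set) \<Rightarrow> nat \<Rightarrow> nat \<Rightarrow> real^'n \<Rightarrow> real^'n \<Rightarrow> bool" where
  "valid_state D M i q p \<longleftrightarrow> q \<in> D i \<or> (q \<in> interfaces D M \<and> arrives_from (D i) q p)"

definition impact_within :: "(nat \<Rightarrow> (real^'n) set) \<Rightarrow> nat \<Rightarrow> real \<Rightarrow> real^'n \<Rightarrow> real^'n \<Rightarrow> bool" where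
  "impact_within D M t q p \<longleftrightarrow> (\<exists>s\<in>{0..t}. q + s *\<^sub>R p \<in> interfaces D M)"

text \<open>Meaningful only if there is a hit at some nonnegative time; the infimum is then attained,
  the interfaces being closed.\<close>

definition hit_time :: "(nat \<Rightarrow> (real^'n) set) \<Rightarrow> nat \<Rightarrow> real^'n \<Rightarrow> real^'n \<Rightarrow> real" where
  "hit_time D M q p = Inf {s. 0 \<le> s \<and> q + s *\<^sub>R p \<in> interfaces D M}"

definition hit_pos :: "(nat \<Rightarrow> (real^'n) set) \<Rightarrow> nat \<Rightarrow> real^'n \<Rightarrow> real^'n \<Rightarrow> real^'n" where
  "hit_pos D M q p = q + hit_time D M q p *\<^sub>R p"

definition region_beyond :: "(nat \<Rightarrow> (real^'n) set) \<Rightarrow> nat \<Rightarrow> nat \<Rightarrow> real^'n \<Rightarrow> nat" where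
  "region_beyond D M i x = (THE j. j \<in> {1..M} \<and> x \<in> interface D i j)"

definition normal_part :: "real^'n \<Rightarrow> real^'n \<Rightarrow> real^'n" where
  "normal_part n p = (p \<bullet> n) *\<^sub>R n"

text \<open>In the borderline case \<open>(norm (normal_part n p))\<^sup>2 / 2 = \<Delta>V\<close> the map is undefined in the
  mathematics; the value assigned to it here is irrelevant, as \<open>condition2\<close> excludes the case.\<close>

definition impact_momentum :: "real^'n \<Rightarrow> real \<Rightarrow> real^'n \<Rightarrow> real^'n" where
  "impact_momentum n \<Delta>V p =
     (let pn = normal_part n p; pt = p - pn in
      if (norm pn)\<^sup>2 / 2 < \<Delta>V then pt - pn else pt + sqrt ((norm pn)\<^sup>2 - 2 * \<Delta>V) *\<^sub>R n)"

definition hit_normal :: "(nat \<Rightarrow> (real^'n) set) \<Rightarrow> nat \<Rightarrow> nat \<Rightarrow> real^'n \<Rightarrow> real^'n \<Rightarrow> real^'n" where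
  "hit_normal D M i q p =
     (let x = hit_pos D M q p in unit_normal D i (region_beyond D M i x) x)"

definition hit_jump :: "(nat \<Rightarrow> (real^'n) set) \<Rightarrow> nat \<Rightarrow> (nat \<Rightarrow> real) \<Rightarrow> nat \<Rightarrow> real^'n \<Rightarrow> real^'n \<Rightarrow> real" where
  "hit_jump D M V i q p = V (region_beyond D M i (hit_pos D M q p)) - V i"

definition bounce :: "(nat \<Rightarrow> (real^'n) set) \<Rightarrow> nat \<Rightarrow> (nat \<Rightarrow> real) \<Rightarrow> nat \<Rightarrow> real^'n \<Rightarrow> real^'n \<Rightarrow> real^'n" where
  "bounce D M V i q p = impact_momentum (hit_normal D M i q p) (hit_jump D M V i q p) p"

definition phi2 :: "(nat \<Rightarrow> (real^'n) set) \<Rightarrow> nat \<Rightarrow> (nat \<Rightarrow> real) \<Rightarrow> nat \<Rightarrow> real \<Rightarrow>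
    (real^'n) \<times> (real^'n) \<Rightarrow> (real^'n) \<times> (real^'n)" where
  "phi2 D M V i \<delta> = (\<lambda>(q, p).
     if impact_within D M \<delta> q p
     then (hit_pos D M q p + (\<delta> - hit_time D M q p) *\<^sub>R bounce D M V i q p, bounce D M V i q p)
     else (q + \<delta> *\<^sub>R p, p))"


section \<open>Standing assumptions along one step\<close>

text \<open>The trajectory of a step of length \<open>\<delta>\<close> is \<open>t \<mapsto> phi2 D M V i t (q, p)\<close> for \<open>0 \<le> t \<le> \<delta>\<close>.\<close>

definition single_impact ::
    "(nat \<Rightarrow> (real^'n) set) \<Rightarrow> nat \<Rightarrow> (nat \<Rightarrow> real) \<Rightarrow> nat \<Rightarrow> real \<Rightarrow> real^'n \<Rightarrow> real^'n \<Rightarrow> bool" where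
  "single_impact D M V i \<delta> q p \<longleftrightarrow>
     (\<forall>t\<in>{0..\<delta>}. fst (phi2 D M V i t (q, p)) \<in> interfaces D M \<longrightarrow> t = hit_time D M q p)"

definition condition1 ::
    "(nat \<Rightarrow> (real^'n) set) \<Rightarrow> nat \<Rightarrow> (nat \<Rightarrow> real) \<Rightarrow> nat \<Rightarrow> real \<Rightarrow> real^'n \<Rightarrow> real^'n \<Rightarrow> bool" where
  "condition1 D M V i \<delta> q p \<longleftrightarrow>
     (\<forall>t\<in>{0..\<delta>}. \<forall>k\<in>{1..M}. \<forall>l\<in>{1..M}. \<forall>k'\<in>{1..M}. \<forall>l'\<in>{1..M}.
        fst (phi2 D M V i t (q, p)) \<in> interface D k l \<inter> interface D k' l' \<longrightarrow> {k, l} = {k', l'})"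

text \<open>The momentum jumps at the time of impact: the second component of \<open>phi2\<close> is then the outgoing
  momentum, and the incident momentum \<open>p\<close> has to be non-tangential too.  The last conjunct
  excludes the transition between reflection and refraction.\<close>

definition condition2 ::
    "(nat \<Rightarrow> (real^'n) set) \<Rightarrow> nat \<Rightarrow> (nat \<Rightarrow> real) \<Rightarrow> nat \<Rightarrow> real \<Rightarrow> real^'n \<Rightarrow> real^'n \<Rightarrow> bool" where
  "condition2 D M V i \<delta> q p \<longleftrightarrow>
     (\<forall>t\<in>{0..\<delta>}. \<forall>k\<in>{1..M}. \<forall>l\<in>{1..M}. fst (phi2 D M V i t (q, p)) \<in> interface D k l \<longrightarrow>
        snd (phi2 D M V i t (q, p)) \<notin> tangent_space (interface D k l) (fst (phi2 D M V i t (q, p))) \<and>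
        (t = hit_time D M q p \<longrightarrow>
           p \<notin> tangent_space (interface D k l) (fst (phi2 D M V i t (q, p))))) \<and>
     (impact_within D M \<delta> q p \<longrightarrow>
        (norm (normal_part (hit_normal D M i q p) p))\<^sup>2 / 2 \<noteq> hit_jump D M V i q p)"


section \<open>Jacobian matrices on phase space\<close>

text \<open>Phase space in coordinates: \<open>Inl\<close> indexes positions and \<open>Inr\<close> momenta.\<close>

definition phase_vec :: "(real^'n) \<times> (real^'n) \<Rightarrow> real^('n::finite + 'n)" where
  "phase_vec z = (\<chi> k. case k of Inl a \<Rightarrow> fst z $ a | Inr a \<Rightarrow> snd z $ a)"

definition phase_pair :: "real^('n::finite + 'n) \<Rightarrow> (real^'n) \<times> (real^'n)" where
  "phase_pair x = (\<chi> a. x $ Inl a, \<chi> a. x $ Inr a)"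

definition has_jacobian_within ::
    "((real^'n) \<times> (real^'n) \<Rightarrow> (real^'n) \<times> (real^'n)) \<Rightarrow> real^('n::finite + 'n)^('n::finite + 'n) \<Rightarrow>
     (real^'n) \<times> (real^'n) \<Rightarrow> ((real^'n) \<times> (real^'n)) set \<Rightarrow> bool" where
  "has_jacobian_within F J z S \<longleftrightarrow>
     ((\<lambda>x. phase_vec (F (phase_pair x))) has_derivative (\<lambda>h. J *v h)) (at (phase_vec z) within phase_vec ` S)"

definition Omega :: "real^('n::finite + 'n)^('n::finite + 'n)" where
  "Omega = (\<chi> r c. case (r, c) of
      (Inl a, Inr b) \<Rightarrow> (mat 1 :: real^'n^'n) $ a $ b
    | (Inr a, Inl b) \<Rightarrow> - (mat 1 :: real^'n^'n) $ a $ b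
    | _ \<Rightarrow> 0)"

text \<open>The states on which the impact formula is the one in force.  Near a state
  satisfying \<open>condition1\<close> and \<open>condition2\<close> whose hitting time lies strictly between \<open>0\<close> and \<open>\<delta>\<close>,
  this is a neighbourhood, so that a derivative within it is an ordinary one; at hitting time
  \<open>0\<close> or \<open>\<delta>\<close> the derivative is one-sided, and still unique.\<close>

definition impact_states :: "(nat \<Rightarrow> (real^'n) set) \<Rightarrow> nat \<Rightarrow> nat \<Rightarrow> real \<Rightarrow> ((real^'n) \<times> (real^'n)) set" where
  "impact_states D M i \<delta> = {(q, p). valid_state D M i q p \<and> impact_within D M \<delta> q p}"

end

theory Submission
  imports Defs
begin

text \<open>Write \<open>x\<close> for the hitting position, \<open>T\<close> for the hitting time and \<open>P\<close> for the outgoing momentum,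
  all as functions of the initial state, and \<open>\<omega>\<close> for the symplectic form.  Since the kinetic energy
  changes by a locally constant amount, the terms with \<open>T'\<close> cancel and
  \<open>\<omega>((Q'h, P'h), (Q'k, P'k)) - \<omega>(h, k) = x'h \<bullet> (P - p)'k - x'k \<bullet> (P - p)'h\<close>.
  As \<open>P - p\<close> is normal to the interface, this vanishes by the symmetry of the shape operator.

  The interface is only \<open>C\<^sup>1\<close>, so its normal need not be differentiable.  But where \<open>P\<close> is
  differentiable and \<open>P \<noteq> p\<close>, the normal direction is that of \<open>P - p\<close>, hence differentiable at this
  one point.  Symmetry then follows from that of the second derivative, at this point, of the hitting
  time in the fixed direction \<open>p\<close>, whose gradient is a normal field.  If \<open>P = p\<close>, then \<open>(P - p)'h\<close>
  is itself normal.

  Impacts at the ends of the step give one-sided derivatives only; the identities between linear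
  maps above are then obtained on a half-space of directions, which suffices.\<close>

section \<open>Derivatives\<close>

text \<open>The obstacle is that the derivative of the flow is given at a single state, and possibly
  on one side only, whereas the normal has to be differentiated in all directions along the
  interface. Let \<open>Y\<close> project along \<open>p0\<close> onto the interface, and let
  \<open>N u\<close> be the gradient of the hitting time of the path with velocity \<open>p0\<close>
  that is at \<open>u\<close> at time \<open>s0\<close>. It is the normal at \<open>Y u\<close>,
  scaled so that \<open>N u \<bullet> p0 = - 1\<close>; this scaling does not depend on the function
  that defines the interface. Every normal vector \<open>w\<close> there satisfies
  \<open>w = - (w \<bullet> p0) N\<close>, so a nonzero momentum jump determines \<open>N\<close>.
  Near the given state, all states with momentum \<open>p0\<close> that hit at time
  \<open>s0\<close> exactly are impact states, even if \<open>s0\<close> is 0 or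
  \<open>\<delta>\<close>. Restricting the momentum jump to them and composing with \<open>Y\<close>
  gives a function on a full neighbourhood of the impact point; this is how a one-sided derivative
  of the flow yields a two-sided one of \<open>N\<close>.\<close>

lemma second_difference_estimate:
  fixes f :: "'a::real_inner \<Rightarrow> real"
  assumes f: "\<And>y. norm (y - x) < r \<Longrightarrow> (f has_derivative (\<lambda>h. N y \<bullet> h)) (at y)"
    and N: "\<And>y. norm (y - x) < r \<Longrightarrow> norm (N y - N x - H (y - x)) \<le> e * norm (y - x)"
    and H: "linear H" and e: "0 \<le> e"
    and t: "0 < t" "t * (norm h + norm k) < r"
  shows "\<bar>f (x + t *\<^sub>R h + t *\<^sub>R k) - f (x + t *\<^sub>R h) - f (x + t *\<^sub>R k) + f x - t\<^sup>2 * (H h \<bullet> k)\<bar>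
         \<le> t\<^sup>2 * (2 * e * (norm h + norm k) * norm k)"
proof -
  \<comment> \<open>The mean value theorem turns \<open>\<phi> t - \<phi> 0\<close> into a
    difference of two gradients, at points within \<open>t * (norm h + norm k)\<close> of
    \<open>x\<close>. Both are expanded at \<open>x\<close>; the two remainders \<open>R t\<close>
    and \<open>R 0\<close> give the factor 2 in the bound.\<close>
  define \<phi> where "\<phi> s = f (x + t *\<^sub>R h + s *\<^sub>R k) - f (x + s *\<^sub>R k)" for s
  have near: "norm (c *\<^sub>R h + s *\<^sub>R k) \<le> t * (norm h + norm k)"
    if "0 \<le> s" "s \<le> t" "0 \<le> c" "c \<le> t" for s c
  proof -
    have "norm (c *\<^sub>R h + s *\<^sub>R k) \<le> c * norm h + s * norm k"
      using that norm_triangle_ineq[of "c *\<^sub>R h" "s *\<^sub>R k"] by simp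
    also have "\<dots> \<le> t * norm h + t * norm k"
      using that by (intro add_mono mult_right_mono) auto
    finally show ?thesis by (simp add: algebra_simps)
  qed
  have small: "norm ((x + c *\<^sub>R h + s *\<^sub>R k) - x) < r" if "0 \<le> s" "s \<le> t" "0 \<le> c" "c \<le> t" for s c
    using near[OF that] t(2) by (simp add: algebra_simps)
  have der: "((\<lambda>s. f (x + c *\<^sub>R h + s *\<^sub>R k)) has_derivative (\<lambda>d. N (x + c *\<^sub>R h + s *\<^sub>R k) \<bullet> (d *\<^sub>R k)))
      (at s within {0..t})" if "0 \<le> s" "s \<le> t" "0 \<le> c" "c \<le> t" for s c
  proof -
    have "((\<lambda>s. x + c *\<^sub>R h + s *\<^sub>R k) has_derivative (\<lambda>d. d *\<^sub>R k)) (at s within {0..t})"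
      by (auto intro!: derivative_eq_intros)
    from has_derivative_compose[OF this, of f, OF f[OF small[OF that]]] show ?thesis .
  qed
  have "\<exists>s\<in>{0<..<t}. \<phi> t - \<phi> 0 = N (x + t *\<^sub>R h + s *\<^sub>R k) \<bullet> ((t - 0) *\<^sub>R k) - N (x + s *\<^sub>R k) \<bullet> ((t - 0) *\<^sub>R k)"
    unfolding \<phi>_def
  proof (rule mvt_simple[OF t(1)])
    fix s assume s: "0 \<le> s" "s \<le> t"
    show "((\<lambda>s. f (x + t *\<^sub>R h + s *\<^sub>R k) - f (x + s *\<^sub>R k)) has_derivative
        (\<lambda>d. N (x + t *\<^sub>R h + s *\<^sub>R k) \<bullet> (d *\<^sub>R k) - N (x + s *\<^sub>R k) \<bullet> (d *\<^sub>R k))) (at s within {0..t})"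
      using has_derivative_diff[OF der[OF s, of t] der[OF s, of 0]] t by simp
  qed
  then obtain s where s: "0 < s" "s < t"
    and eq: "\<phi> t - \<phi> 0 = t * ((N (x + t *\<^sub>R h + s *\<^sub>R k) - N (x + s *\<^sub>R k)) \<bullet> k)"
    by (auto simp: inner_diff_left algebra_simps)
  define R where "R c = N (x + c *\<^sub>R h + s *\<^sub>R k) - N x - H (c *\<^sub>R h + s *\<^sub>R k)" for c
  have Rb: "norm (R c) \<le> e * (t * (norm h + norm k))" if "0 \<le> c" "c \<le> t" for c
  proof -
    have "norm (R c) \<le> e * norm (c *\<^sub>R h + s *\<^sub>R k)"
      using N[OF small[of s c]] that s unfolding R_def by (simp add: add.assoc)
    also have "\<dots> \<le> e * (t * (norm h + norm k))"
      using e near[of s c] that s by (auto intro!: mult_left_mono)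
    finally show ?thesis .
  qed
  have "H (t *\<^sub>R h + s *\<^sub>R k) - H (s *\<^sub>R k) = t *\<^sub>R H h"
    using H by (simp add: linear_add linear_scale)
  then have "N (x + t *\<^sub>R h + s *\<^sub>R k) - N (x + s *\<^sub>R k) = t *\<^sub>R H h + (R t - R 0)"
    unfolding R_def by (simp add: algebra_simps)
  then have "\<phi> t - \<phi> 0 - t\<^sup>2 * (H h \<bullet> k) = t * ((R t - R 0) \<bullet> k)"
    unfolding eq by (simp only: inner_add_left) (simp add: power2_eq_square algebra_simps)
  then have "\<bar>\<phi> t - \<phi> 0 - t\<^sup>2 * (H h \<bullet> k)\<bar> = t * \<bar>(R t - R 0) \<bullet> k\<bar>"
    using t by (simp add: abs_mult)
  also have "\<dots> \<le> t * ((e * (t * (norm h + norm k)) + e * (t * (norm h + norm k))) * norm k)"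
    using t Rb[of t] Rb[of 0] norm_triangle_ineq4[of "R t" "R 0"]
    by (intro mult_left_mono order_trans[OF Cauchy_Schwarz_ineq2] mult_right_mono) auto
  finally show ?thesis
    unfolding \<phi>_def by (simp add: power2_eq_square algebra_simps)
qed

text \<open>The second difference is symmetric in \<open>h\<close> and \<open>k\<close>, so
  \<open>t\<^sup>2 * (H h \<bullet> k)\<close> and \<open>t\<^sup>2 * (H k \<bullet> h)\<close>
  approximate the same number up to o(t^2). This is Schwarz's theorem for a gradient differentiable
  at the one point \<open>x\<close>.\<close>

lemma has_gradient_derivative_symmetric:
  fixes f :: "'a::real_inner \<Rightarrow> real"
  assumes f: "\<forall>\<^sub>F y in nhds x. (f has_derivative (\<lambda>h. N y \<bullet> h)) (at y)"
    and N: "(N has_derivative H) (at x)"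
  shows "H h \<bullet> k = H k \<bullet> h"
proof -
  \<comment> \<open>The two bounds from \<open>second_difference_estimate\<close> add up to at most
    \<open>t\<^sup>2 * (\<epsilon> * C)\<close>; the \<open>+ 1\<close> in
    \<open>\<epsilon> = e / (C + 1)\<close> covers \<open>h = k = 0\<close>, where
    \<open>C = 0\<close>.\<close>
  define C where "C = 4 * (norm h + norm k)\<^sup>2"
  obtain r0 where r0: "r0 > 0" "\<And>y. norm (y - x) < r0 \<Longrightarrow> (f has_derivative (\<lambda>h. N y \<bullet> h)) (at y)"
    using f unfolding eventually_nhds_metric dist_norm by blast
  have H: "linear H" using N by (rule has_derivative_linear)
  have "\<bar>H h \<bullet> k - H k \<bullet> h\<bar> \<le> 0 + e" if "e > 0" for e
  proof -
    define \<epsilon> where "\<epsilon> = e / (C + 1)"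
    have C: "C \<ge> 0" unfolding C_def by simp
    then have \<epsilon>: "\<epsilon> > 0" using that unfolding \<epsilon>_def by simp
    obtain d where d: "d > 0" "\<And>y. norm (y - x) < d \<Longrightarrow> norm (N y - N x - H (y - x)) \<le> \<epsilon> * norm (y - x)"
      using N \<epsilon> unfolding has_derivative_at_alt by blast
    define r where "r = min r0 d"
    define t where "t = r / (2 * (norm h + norm k + 1))"
    have np: "norm h + norm k + 1 > 0" using norm_ge_zero[of h] norm_ge_zero[of k] by linarith
    have r: "r > 0" using r0 d unfolding r_def by simp
    have t: "t > 0" using r np unfolding t_def by (intro divide_pos_pos) auto
    have "t * (norm h + norm k) \<le> t * (norm h + norm k + 1)" using t by simp
    also have "\<dots> = r / 2" using np unfolding t_def by (simp add: field_simps)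
    finally have tr: "t * (norm h + norm k) < r" using r by simp
    have *: "\<bar>f (x + t *\<^sub>R a + t *\<^sub>R b) - f (x + t *\<^sub>R a) - f (x + t *\<^sub>R b) + f x - t\<^sup>2 * (H a \<bullet> b)\<bar>
         \<le> t\<^sup>2 * (2 * \<epsilon> * (norm a + norm b) * norm b)" if "norm a + norm b = norm h + norm k" for a b
      by (rule second_difference_estimate[where r = r]) (use r0 d H \<epsilon> t tr that in \<open>auto simp: r_def\<close>)
    have **: "2 * \<epsilon> * (norm h + norm k) * c \<le> 2 * \<epsilon> * (norm h + norm k)\<^sup>2"
      if "c \<le> norm h + norm k" for c
      using that \<epsilon> by (simp add: power2_eq_square mult.assoc mult_left_mono)
    have "t\<^sup>2 * \<bar>H h \<bullet> k - H k \<bullet> h\<bar> = \<bar>t\<^sup>2 * (H h \<bullet> k) - t\<^sup>2 * (H k \<bullet> h)\<bar>"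
      by (simp add: abs_mult right_diff_distrib[symmetric])
    also have "\<dots> \<le> t\<^sup>2 * (2 * \<epsilon> * (norm h + norm k) * norm k) + t\<^sup>2 * (2 * \<epsilon> * (norm h + norm k) * norm h)"
      using *[of h k] *[of k h] by (simp add: add.commute add.left_commute)
    also have "\<dots> = t\<^sup>2 * (2 * \<epsilon> * (norm h + norm k) * norm k + 2 * \<epsilon> * (norm h + norm k) * norm h)"
      by (simp add: algebra_simps)
    also have "\<dots> \<le> t\<^sup>2 * (\<epsilon> * C)"
      using **[of "norm h"] **[of "norm k"] unfolding C_def
      by (intro mult_left_mono) auto
    finally have "\<bar>H h \<bullet> k - H k \<bullet> h\<bar> \<le> \<epsilon> * C" using t by simp
    also have "\<dots> \<le> e" using that C unfolding \<epsilon>_def by (simp add: field_simps)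
    finally show ?thesis by simp
  qed
  then have "\<bar>H h \<bullet> k - H k \<bullet> h\<bar> \<le> 0" by (rule field_le_epsilon)
  then show ?thesis by simp
qed

text \<open>The hypothesis on \<open>h\<close> says that \<open>h\<close> is in the contingent (Bouligand) cone of \<open>S\<close> at \<open>z\<close>.\<close>

lemma has_derivative_within_zero_on_contingent:
  assumes f: "(f has_derivative f') (at z within S)"
    and f0: "\<forall>\<^sub>F x in at z within S. f x = 0" "f z = 0"
    and cone: "\<And>e. e > 0 \<Longrightarrow> \<exists>t\<in>{0<..<e}. \<exists>x\<in>S. norm (x - z - t *\<^sub>R h) \<le> e * t"
  shows "f' h = 0"
proof -
  interpret bounded_linear f' using f by (rule has_derivative_bounded_linear)
  obtain K where K: "K > 0" "\<And>x. norm (f' x) \<le> norm x * K" using pos_bounded by blast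
  obtain d0 where d0: "d0 > 0" "\<And>x. x \<in> S \<Longrightarrow> norm (x - z) < d0 \<Longrightarrow> f x = 0"
    using f0 unfolding eventually_at dist_norm by metis
  \<comment> \<open>\<open>t *\<^sub>R f' h\<close> is split as
    \<open>f' (x - z) - f' (x - z - t *\<^sub>R h)\<close>. The first term is small because
    \<open>f\<close> vanishes at \<open>x\<close> and \<open>z\<close>, the second because
    \<open>x\<close> is close to the ray; they contribute \<open>norm h + 1\<close> and
    \<open>K\<close>.\<close>
  define C where "C = norm h + 1 + K"
  have C: "C > 0" using K norm_ge_zero[of h] unfolding C_def by linarith
  have "norm (f' h) \<le> 0 + e" if "e > 0" for e
  proof -
    define \<epsilon> where "\<epsilon> = e / C"
    have \<epsilon>: "\<epsilon> > 0" using that C unfolding \<epsilon>_def by simp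
    obtain d where d: "d > 0" "\<And>x. x \<in> S \<Longrightarrow> norm (x - z) < d \<Longrightarrow>
        norm (f x - f z - f' (x - z)) \<le> \<epsilon> * norm (x - z)"
      using f \<epsilon> unfolding has_derivative_within_alt by blast
    define b where "b = min (min \<epsilon> 1) (min d0 d / (norm h + 1))"
    have n: "norm h + 1 > 0" using norm_ge_zero[of h] by linarith
    have b: "b > 0" "b \<le> \<epsilon>" "b \<le> 1" using \<epsilon> d0(1) d(1) n unfolding b_def by simp_all
    have "b \<le> min d0 d / (norm h + 1)" unfolding b_def by (rule min.cobounded2)
    then have b4: "b * (norm h + 1) \<le> min d0 d" using n by (simp only: pos_le_divide_eq)
    obtain t x where t: "0 < t" "t < b" and x: "x \<in> S" "norm (x - z - t *\<^sub>R h) \<le> b * t"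
      using cone[OF b(1)] by auto
    have "norm (x - z) \<le> norm (x - z - t *\<^sub>R h) + norm (t *\<^sub>R h)"
      using norm_triangle_ineq[of "x - z - t *\<^sub>R h" "t *\<^sub>R h"] by simp
    also have "\<dots> \<le> b * t + t * norm h" using x t by simp
    also have "\<dots> \<le> 1 * t + t * norm h" using b t by (intro add_mono mult_right_mono) auto
    finally have xz: "norm (x - z) \<le> t * (norm h + 1)" by (simp add: algebra_simps)
    also have "\<dots> < b * (norm h + 1)" using t n by simp
    finally have "norm (x - z) < min d0 d" using b4 by linarith
    then have "norm (f' (x - z)) \<le> \<epsilon> * norm (x - z)"
      using d(2)[OF x(1)] d0(2)[OF x(1)] f0(2) by simp
    also have "\<dots> \<le> \<epsilon> * (t * (norm h + 1))" using xz \<epsilon> by simp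
    finally have 1: "norm (f' (x - z)) \<le> \<epsilon> * (t * (norm h + 1))" .
    have "norm (f' (x - z - t *\<^sub>R h)) \<le> (b * t) * K"
      using K x by (meson mult_right_mono order_trans less_imp_le)
    also have "\<dots> \<le> (\<epsilon> * t) * K" using b t K by (intro mult_right_mono) auto
    finally have 2: "norm (f' (x - z - t *\<^sub>R h)) \<le> \<epsilon> * t * K" .
    have "t * norm (f' h) = norm (f' (x - z) - f' (x - z - t *\<^sub>R h))"
      using t by (simp add: diff scaleR)
    also have "\<dots> \<le> \<epsilon> * (t * (norm h + 1)) + \<epsilon> * t * K"
      using 1 2 norm_triangle_ineq4[of "f' (x - z)" "f' (x - z - t *\<^sub>R h)"] by linarith
    also have "\<dots> = t * (\<epsilon> * C)" unfolding C_def by (simp add: algebra_simps)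
    also have "\<epsilon> * C = e" using C unfolding \<epsilon>_def by simp
    finally show ?thesis using t by simp
  qed
  then have "norm (f' h) \<le> 0" by (rule field_le_epsilon)
  then show ?thesis by simp
qed

text \<open>An open half-space spans: \<open>a\<close> and, for large \<open>c\<close>,
  \<open>h + c *\<^sub>R a\<close> lie in it, and \<open>h\<close> is a combination of the
  two.\<close>

lemma linear_eq_0_on_halfspace:
  fixes f :: "'a::real_vector \<Rightarrow> 'b::real_vector" and l :: "'a \<Rightarrow> real"
  assumes "linear f" "linear l" and a: "l a > 0" and f: "\<And>h. l h > 0 \<Longrightarrow> f h = 0"
  shows "f h = 0"
proof -
  define c where "c = (\<bar>l h\<bar> + 1) / l a"
  have "l (h + c *\<^sub>R a) = l h + \<bar>l h\<bar> + 1"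
    using a assms(2) by (simp add: linear_add linear_scale c_def)
  then have "f (h + c *\<^sub>R a) = 0" by (intro f) linarith
  then show ?thesis using f[OF a] assms(1) by (simp add: linear_add linear_scale)
qed

text \<open>In the product rule the derivative of \<open>m\<close> would be multiplied by
  \<open>a x = 0\<close>, so a limit of \<open>m\<close> is enough. This serves the case of a
  vanishing momentum jump, where the normal is only known to be continuous.\<close>

lemma has_derivative_scaleR_vanishing:
  fixes a :: "'a::real_normed_vector \<Rightarrow> real" and m :: "'a \<Rightarrow> 'b::real_normed_vector"
  assumes a: "(a has_derivative a') (at x within S)" and a0: "a x = 0"
    and m: "(m \<longlongrightarrow> l) (at x within S)"
  shows "((\<lambda>y. a y *\<^sub>R m y) has_derivative (\<lambda>h. a' h *\<^sub>R l)) (at x within S)"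
proof -
  have bl: "bounded_linear a'" using a by (rule has_derivative_bounded_linear)
  have tm: "((\<lambda>y. ((1 / norm (y - x)) *\<^sub>R (a y - (a x + a' (y - x)))) *\<^sub>R m y) \<longlongrightarrow> 0 *\<^sub>R l) (at x within S)"
    using a m unfolding has_derivative_within by (intro tendsto_intros) auto
  obtain K where K: "\<And>h. norm (a' h) \<le> norm h * K" using bounded_linear.bounded[OF bl] by blast
  have ml: "((\<lambda>y. K * norm (m y - l)) \<longlongrightarrow> K * norm (l - l)) (at x within S)"
    by (intro tendsto_intros m)
  have t2: "((\<lambda>y. (a' (y - x) / norm (y - x)) *\<^sub>R (m y - l)) \<longlongrightarrow> 0) (at x within S)"
  proof (rule Lim_null_comparison)
    show "\<forall>\<^sub>F y in at x within S. norm ((a' (y - x) / norm (y - x)) *\<^sub>R (m y - l)) \<le> K * norm (m y - l)"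
      unfolding eventually_at
    proof (intro exI[of _ 1] conjI ballI impI)
      fix y assume "y \<noteq> x \<and> dist y x < 1"
      then have "\<bar>a' (y - x) / norm (y - x)\<bar> \<le> K" using K[of "y - x"] by (simp add: divide_le_eq mult.commute)
      then show "norm ((a' (y - x) / norm (y - x)) *\<^sub>R (m y - l)) \<le> K * norm (m y - l)"
        by (simp add: mult_right_mono del: abs_divide)
    qed simp
    show "((\<lambda>y. K * norm (m y - l)) \<longlongrightarrow> 0) (at x within S)" using ml by simp
  qed
  have "((\<lambda>y. (1 / norm (y - x)) *\<^sub>R (a y *\<^sub>R m y - (a x *\<^sub>R m x + a' (y - x) *\<^sub>R l))) \<longlongrightarrow> 0) (at x within S)"
    using tendsto_add[OF tm t2]
    by (rule Lim_transform_eventually[OF _ always_eventually, THEN tendsto_eq_rhs])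
       (auto simp: a0 algebra_simps diff_divide_distrib)
  moreover have "bounded_linear (\<lambda>h. a' h *\<^sub>R l)"
    by (rule bounded_linear_compose[OF bounded_linear_scaleR_left bl])
  ultimately show ?thesis unfolding has_derivative_within by blast
qed

lemma isCont_tendsto_nhds: "isCont f a \<Longrightarrow> (f \<longlongrightarrow> f a) (nhds a)"
  unfolding isCont_def tendsto_at_iff_tendsto_nhds .

text \<open>Stands in for uniqueness of the derivative when \<open>S\<close> reaches
  \<open>z\<close> from one side only: an identity that holds on \<open>S\<close> can be
  differentiated in every direction, not only in those that \<open>S\<close> admits.\<close>

lemma has_derivative_within_zero_unique:
  assumes f: "(f has_derivative f') (at z within S)"
    and l: "linear l" "l b > (0::real)"
    and cone: "\<And>h e. l h > 0 \<Longrightarrow> e > 0 \<Longrightarrow> \<exists>t\<in>{0<..<e}. \<exists>x\<in>S. norm (x - z - t *\<^sub>R h) \<le> e * t"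
    and f0: "\<forall>\<^sub>F x in at z within S. f x = 0" "f z = 0"
  shows "f' h = 0"
  by (rule linear_eq_0_on_halfspace[OF has_derivative_linear[OF f] l])
     (rule has_derivative_within_zero_on_contingent[OF f f0 cone])

section \<open>Hitting times of level sets\<close>

text \<open>\<open>T\<close> is already given and continuous, so differentiability of
  \<open>\<Phi>\<close> at one point suffices. The zero condition first yields a bound
  \<open>\<bar>T y - T z\<bar> \<le> C * norm (y - z)\<close>, which makes the error in
  \<open>\<Phi>\<close> small relative to \<open>norm (y - z)\<close>.\<close>

lemma implicit_has_derivative:
  fixes \<Phi> :: "'a::real_normed_vector \<times> real \<Rightarrow> real"
  assumes \<Phi>: "(\<Phi> has_derivative (\<lambda>(h, k). L h + c * k)) (at (z, T z))"
    and c: "c \<noteq> 0" and cont: "isCont T z"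
    and zero: "\<forall>\<^sub>F y in nhds z. \<Phi> (y, T y) = 0"
  shows "(T has_derivative (\<lambda>h. - L h / c)) (at z)"
proof -
  have "bounded_linear ((\<lambda>(h, k). L h + c * k) \<circ> (\<lambda>h. (h, 0)))"
    using \<Phi> by (intro bounded_linear_compose[unfolded o_def[symmetric]] has_derivative_bounded_linear)
      (auto intro!: bounded_linear_intros)
  then have L: "bounded_linear L" by (simp add: o_def)
  then obtain K where K: "K > 0" "\<And>h. norm (L h) \<le> norm h * K"
    using bounded_linear.pos_bounded by blast
  define C where "C = 2 * (K + \<bar>c\<bar> / 2) / \<bar>c\<bar>"
  have C: "C > 0" using K c unfolding C_def by (intro divide_pos_pos) auto
  show ?thesis
    unfolding has_derivative_at_alt
  proof (intro conjI allI impI)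
    show "bounded_linear (\<lambda>h. - L h / c)"
      using bounded_linear_compose[OF bounded_linear_divide bounded_linear_minus[OF L]] .
    fix e :: real assume e: "e > 0"
    \<comment> \<open>The bound \<open>\<bar>c\<bar> / 2\<close> lets
      \<open>\<epsilon> * \<bar>k\<bar>\<close> be absorbed into
      \<open>\<bar>c\<bar> * \<bar>k\<bar>\<close>, which produces \<open>C\<close>; the second one
      makes the final error \<open>\<epsilon> * (1 + C)\<close> at most
      \<open>e * \<bar>c\<bar>\<close>.\<close>
    define \<epsilon> where "\<epsilon> = min (\<bar>c\<bar> / 2) (e * \<bar>c\<bar> / (1 + C))"
    have "\<epsilon> > 0" using c e C unfolding \<epsilon>_def by simp
    moreover have "\<epsilon> \<le> e * \<bar>c\<bar> / (1 + C)" unfolding \<epsilon>_def by (rule min.cobounded2)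
    then have "\<epsilon> * (1 + C) \<le> e * \<bar>c\<bar>" using C by (simp add: pos_le_divide_eq)
    moreover have "\<epsilon> \<le> \<bar>c\<bar> / 2" unfolding \<epsilon>_def by (rule min.cobounded1)
    ultimately have \<epsilon>: "\<epsilon> > 0" "\<epsilon> \<le> \<bar>c\<bar> / 2" "\<epsilon> * (1 + C) \<le> e * \<bar>c\<bar>" by auto
    obtain d where d: "d > 0" "\<And>y. norm (y - (z, T z)) < d \<Longrightarrow>
        norm (\<Phi> y - \<Phi> (z, T z) - (\<lambda>(h, k). L h + c * k) (y - (z, T z))) \<le> \<epsilon> * norm (y - (z, T z))"
      using \<Phi> \<epsilon>(1) unfolding has_derivative_at_alt by blast
    obtain d1 where d1: "d1 > 0" "\<And>y. norm (y - z) < d1 \<Longrightarrow> \<Phi> (y, T y) = 0"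
      using zero unfolding eventually_nhds_metric dist_norm by blast
    obtain d2 where d2: "d2 > 0" "\<And>y. norm (y - z) < d2 \<Longrightarrow> \<bar>T y - T z\<bar> < d / 2"
      using cont d(1) unfolding continuous_at_eps_delta dist_norm by (metis half_gt_zero real_norm_def)
    show "\<exists>r>0. \<forall>y. norm (y - z) < r \<longrightarrow> norm (T y - T z - - L (y - z) / c) \<le> e * norm (y - z)"
    proof (intro exI[of _ "min (min d1 d2) (d / 2)"] conjI allI impI)
      show "0 < min (min d1 d2) (d / 2)" using d d1 d2 by simp
      fix y assume y: "norm (y - z) < min (min d1 d2) (d / 2)"
      define k where "k = T y - T z"
      have n: "norm ((y, T y) - (z, T z)) \<le> norm (y - z) + \<bar>k\<bar>"
        unfolding k_def using norm_Pair_le[of "y - z" "T y - T z"] by simp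
      have "\<Phi> (y, T y) = 0" "\<Phi> (z, T z) = 0" using d1 y by auto
      moreover have "norm ((y, T y) - (z, T z)) < d" using n d2(2)[of y] y unfolding k_def by auto
      ultimately have "\<bar>L (y - z) + c * k\<bar> \<le> \<epsilon> * norm ((y, T y) - (z, T z))"
        using d(2)[of "(y, T y)"] unfolding k_def by (simp add: abs_minus_commute)
      also have "\<dots> \<le> \<epsilon> * (norm (y - z) + \<bar>k\<bar>)" using n \<epsilon> by simp
      finally have main: "\<bar>L (y - z) + c * k\<bar> \<le> \<epsilon> * (norm (y - z) + \<bar>k\<bar>)" .
      have "\<bar>c\<bar> * \<bar>k\<bar> \<le> \<bar>L (y - z) + c * k\<bar> + \<bar>L (y - z)\<bar>" by (simp add: abs_mult[symmetric])
      also have "\<dots> \<le> \<bar>c\<bar> / 2 * (norm (y - z) + \<bar>k\<bar>) + norm (y - z) * K"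
        using main K(2)[of "y - z"] mult_right_mono[OF \<epsilon>(2), of "norm (y - z) + \<bar>k\<bar>"]
        by (simp only: real_norm_def) (smt (verit) norm_ge_zero)
      finally have "\<bar>c\<bar> * \<bar>k\<bar> \<le> 2 * (K + \<bar>c\<bar> / 2) * norm (y - z)" by (simp add: algebra_simps)
      then have kC: "\<bar>k\<bar> \<le> C * norm (y - z)"
        using c unfolding C_def by (simp add: pos_le_divide_eq mult.commute mult.left_commute)
      have "\<bar>c\<bar> * \<bar>k + L (y - z) / c\<bar> = \<bar>L (y - z) + c * k\<bar>"
        using c by (simp add: abs_mult[symmetric] field_simps)
      also have "\<dots> \<le> \<epsilon> * (norm (y - z) + C * norm (y - z))"
        using main kC \<epsilon> by (smt (verit) mult_left_mono)
      also have "\<dots> = \<epsilon> * (1 + C) * norm (y - z)" by (simp add: algebra_simps)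
      also have "\<dots> \<le> e * \<bar>c\<bar> * norm (y - z)" using \<epsilon>(3) by (intro mult_right_mono) auto
      finally have "\<bar>c\<bar> * \<bar>k + L (y - z) / c\<bar> \<le> \<bar>c\<bar> * (e * norm (y - z))" by (simp add: mult.commute mult.left_commute)
      then show "norm (T y - T z - - L (y - z) / c) \<le> e * norm (y - z)"
        using c unfolding k_def by simp
    qed
  qed
qed

text \<open>For fixed \<open>s\<close> this is a linear map on phase space; it is applied to states
  and also, as its own derivative, to tangent vectors.\<close>

definition drift :: "real \<Rightarrow> 'a::real_vector \<times> 'a \<Rightarrow> 'a" where
  "drift s z = fst z + s *\<^sub>R snd z"

lemma isCont_drift: "isCont (drift s) (z :: 'a::real_normed_vector \<times> 'a)"
  unfolding drift_def[abs_def] by (intro continuous_intros)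

text \<open>Since \<open>G \<bullet> p > 0\<close> persists nearby, \<open>g\<close> strictly
  increases along every neighbouring path during the window of half-width \<open>e\<close>, and the
  intermediate value theorem gives exactly one zero. \<open>T\<close> may be negative or exceed the
  step length, so it is differentiable in all directions even where the impact states are one-sided.
  The sign of \<open>g\<close> later tells the sides of the interface apart.\<close>

lemma implicit_hitting_time:
  fixes g :: "'a::euclidean_space \<Rightarrow> real"
  assumes U: "open U" and g: "\<And>y. y \<in> U \<Longrightarrow> (g has_derivative (\<lambda>h. G y \<bullet> h)) (at y)"
    and G: "continuous_on U G"
    and z0: "drift s0 z0 \<in> U" "g (drift s0 z0) = 0" "G (drift s0 z0) \<bullet> snd z0 > 0"
    and e0: "e0 > 0"
  obtains e \<eta> T where "0 < e" "e \<le> e0" "0 < \<eta>" "T z0 = s0"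
    "\<And>z s. z \<in> ball z0 \<eta> \<Longrightarrow> \<bar>s - s0\<bar> \<le> e \<Longrightarrow> drift s z \<in> U"
    "\<And>z s. z \<in> ball z0 \<eta> \<Longrightarrow> \<bar>s - s0\<bar> \<le> e \<Longrightarrow> G (drift s z) \<bullet> snd z > 0"
    "\<And>z. z \<in> ball z0 \<eta> \<Longrightarrow> \<bar>T z - s0\<bar> < e"
    "\<And>z s. z \<in> ball z0 \<eta> \<Longrightarrow> \<bar>s - s0\<bar> \<le> e \<Longrightarrow> g (drift s z) < 0 \<longleftrightarrow> s < T z"
    "\<And>z s. z \<in> ball z0 \<eta> \<Longrightarrow> \<bar>s - s0\<bar> \<le> e \<Longrightarrow> g (drift s z) = 0 \<longleftrightarrow> s = T z"
    "\<And>z. z \<in> ball z0 \<eta> \<Longrightarrow> (T has_derivative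
        (\<lambda>h. - (G (drift (T z) z) \<bullet> drift (T z) h) / (G (drift (T z) z) \<bullet> snd z))) (at z)"
proof -
  define m where "m w = drift (snd w) (fst w)" for w :: "('a \<times> 'a) \<times> real"
  have m: "continuous_on A m" for A unfolding m_def drift_def by (intro continuous_intros)
  define S where "S = m -` U"
  have S: "open S" unfolding S_def using U m by (intro open_vimage) auto
  have "continuous_on S (\<lambda>w. G (m w) \<bullet> snd (fst w))"
    by (intro continuous_intros continuous_on_compose2[OF G m]) (auto simp: S_def)
  then have "open (S \<inter> (\<lambda>w. G (m w) \<bullet> snd (fst w)) -` {0<..})"
    using S by (intro continuous_open_preimage) auto
  moreover have "(z0, s0) \<in> S \<inter> (\<lambda>w. G (m w) \<bullet> snd (fst w)) -` {0<..}"
    using z0 by (simp add: S_def m_def)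
  ultimately obtain d where d: "d > 0" "\<And>w. dist w (z0, s0) < d \<Longrightarrow>
      w \<in> S \<inter> (\<lambda>w. G (m w) \<bullet> snd (fst w)) -` {0<..}"
    unfolding open_dist by blast
  \<comment> \<open>The product metric is at most the sum of the two distances, so windows of size
    \<open>d / 3\<close> in state and time stay within \<open>d\<close>.\<close>
  define e where "e = min e0 (d / 3)"
  have e: "e > 0" "e \<le> e0" "e \<le> d / 3" using e0 d(1) unfolding e_def by auto
  have near: "drift s z \<in> U \<and> G (drift s z) \<bullet> snd z > 0" if "z \<in> ball z0 (d / 3)" "\<bar>s - s0\<bar> \<le> e" for z s
  proof -
    have "dist (z, s) (z0, s0) \<le> dist z z0 + \<bar>s - s0\<bar>"
      using norm_Pair_le[of "z - z0" "s - s0"] by (simp add: dist_norm)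
    then have "dist (z, s) (z0, s0) < d" using that e d(1) by (simp add: dist_commute)
    from d(2)[OF this] show ?thesis by (simp add: S_def m_def)
  qed
  have mono: "g (drift s z) < g (drift t z)"
    if "z \<in> ball z0 (d / 3)" "\<bar>s - s0\<bar> \<le> e" "\<bar>t - s0\<bar> \<le> e" "s < t" for z s t
  proof (rule DERIV_pos_imp_increasing[OF that(4), of "\<lambda>s. g (drift s z)"])
    fix r assume "s \<le> r" "r \<le> t"
    then have r: "\<bar>r - s0\<bar> \<le> e" using that by linarith
    have "((\<lambda>s. drift s z) has_derivative (\<lambda>h. h *\<^sub>R snd z)) (at r)"
      unfolding drift_def by (auto intro!: derivative_eq_intros)
    from has_derivative_compose[OF this, of g, OF g] near[OF that(1) r]
    have "((\<lambda>s. g (drift s z)) has_derivative (\<lambda>h. G (drift r z) \<bullet> (h *\<^sub>R snd z))) (at r)" by auto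
    then have "DERIV (\<lambda>s. g (drift s z)) r :> G (drift r z) \<bullet> snd z"
      by (rule has_derivative_imp_has_field_derivative) simp
    then show "\<exists>y. DERIV (\<lambda>s. g (drift s z)) r :> y \<and> 0 < y" using near[OF that(1) r] by auto
  qed
  have cont: "isCont (\<lambda>z. g (drift s z)) z" if "drift s z \<in> U" for s z
    using isCont_o2[OF isCont_drift has_derivative_continuous[OF g[OF that]]] .
  have lt: "\<forall>\<^sub>F z in nhds z1. g (drift s z) < 0" if "drift s z1 \<in> U" "g (drift s z1) < 0" for s z1
    using cont[OF that(1)] that(2) unfolding eventually_nhds_conv_at isCont_def
    by (auto intro: order_tendstoD)
  have gt: "\<forall>\<^sub>F z in nhds z1. g (drift s z) > 0" if "drift s z1 \<in> U" "g (drift s z1) > 0" for s z1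
    using cont[OF that(1)] that(2) unfolding eventually_nhds_conv_at isCont_def
    by (auto intro: order_tendstoD)
  have z0b: "z0 \<in> ball z0 (d / 3)" using d(1) by simp
  have "\<forall>\<^sub>F z in nhds z0. g (drift (s0 - e) z) < 0 \<and> g (drift (s0 + e) z) > 0"
    using near[OF z0b, of "s0 - e"] near[OF z0b, of "s0 + e"] mono[OF z0b, of "s0 - e" s0]
      mono[OF z0b, of s0 "s0 + e"] e z0(2)
    by (intro eventually_conj lt gt) auto
  then obtain d' where d': "d' > 0" "\<And>z. dist z z0 < d' \<Longrightarrow> g (drift (s0 - e) z) < 0 \<and> g (drift (s0 + e) z) > 0"
    unfolding eventually_nhds_metric by blast
  define \<eta> where "\<eta> = min (d / 3) d'"
  have \<eta>: "\<eta> > 0" "ball z0 \<eta> \<subseteq> ball z0 (d / 3)" using d d' unfolding \<eta>_def by auto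
  have "\<exists>s. \<bar>s - s0\<bar> < e \<and> g (drift s z) = 0" if z: "z \<in> ball z0 \<eta>" for z
  proof -
    have z': "z \<in> ball z0 (d / 3)" using z \<eta> by auto
    have sg: "g (drift (s0 - e) z) < 0" "g (drift (s0 + e) z) > 0"
      using d'(2)[of z] z unfolding \<eta>_def by (auto simp: dist_commute)
    have "continuous_on {s0 - e..s0 + e} (\<lambda>s. g (drift s z))"
    proof (rule continuous_on_compose2[of U g])
      show "continuous_on U g"
        using g by (intro continuous_at_imp_continuous_on) (auto intro: has_derivative_continuous)
      show "continuous_on {s0 - e..s0 + e} (\<lambda>s. drift s z)"
        unfolding drift_def by (intro continuous_intros)
      show "(\<lambda>s. drift s z) ` {s0 - e..s0 + e} \<subseteq> U" using near[OF z'] by auto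
    qed
    then obtain s where s: "s0 - e \<le> s" "s \<le> s0 + e" "g (drift s z) = 0"
      using IVT'[of "\<lambda>s. g (drift s z)" "s0 - e" 0 "s0 + e"] sg e by auto
    moreover have "s \<noteq> s0 - e" "s \<noteq> s0 + e" using s sg by auto
    ultimately show ?thesis by (intro exI[of _ s]) auto
  qed
  then obtain T where T: "\<And>z. z \<in> ball z0 \<eta> \<Longrightarrow> \<bar>T z - s0\<bar> < e"
    "\<And>z. z \<in> ball z0 \<eta> \<Longrightarrow> g (drift (T z) z) = 0" by metis
  have neg: "g (drift s z) < 0 \<longleftrightarrow> s < T z" if "z \<in> ball z0 \<eta>" "\<bar>s - s0\<bar> \<le> e" for z s
    using mono[of z s "T z"] mono[of z "T z" s] that T[OF that(1)] \<eta> by (cases s "T z" rule: linorder_cases) auto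
  have zero: "g (drift s z) = 0 \<longleftrightarrow> s = T z" if "z \<in> ball z0 \<eta>" "\<bar>s - s0\<bar> \<le> e" for z s
    using mono[of z s "T z"] mono[of z "T z" s] that T[OF that(1)] \<eta> by (cases s "T z" rule: linorder_cases) auto
  have "T z0 = s0" using zero[of z0 s0] \<eta> e z0 by simp
  moreover have "(T has_derivative (\<lambda>h. - (G (drift (T z) z) \<bullet> drift (T z) h) / (G (drift (T z) z) \<bullet> snd z))) (at z)"
    if z: "z \<in> ball z0 \<eta>" for z
  proof (rule implicit_has_derivative[where \<Phi> = "\<lambda>w. g (m w)"])
    have Tz: "\<bar>T z - s0\<bar> \<le> e" using T(1)[OF z] by simp
    have z': "z \<in> ball z0 (d / 3)" using z \<eta> by auto
    have nh: "\<forall>\<^sub>F y in nhds z. y \<in> ball z0 \<eta>" using z by (intro eventually_nhds_in_open) auto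
    have "(m has_derivative (\<lambda>(h, k). drift (T z) h + k *\<^sub>R snd z)) (at (z, T z))"
      unfolding m_def drift_def
      by (rule derivative_eq_intros refl)+ (auto simp: fun_eq_iff case_prod_beta algebra_simps)
    from has_derivative_compose[OF this, of g, OF g] near[OF z' Tz]
    show "((\<lambda>w. g (m w)) has_derivative
        (\<lambda>(h, k). G (drift (T z) z) \<bullet> drift (T z) h + (G (drift (T z) z) \<bullet> snd z) * k)) (at (z, T z))"
      by (simp add: m_def case_prod_unfold inner_add_right mult.commute)
    show "G (drift (T z) z) \<bullet> snd z \<noteq> 0" using near[OF z' Tz] by simp
    show "\<forall>\<^sub>F y in nhds z. g (m (y, T y)) = 0"
      using nh by eventually_elim (simp add: m_def T)
    show "isCont T z"
      unfolding isCont_def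
    proof (rule order_tendstoI)
      fix a assume "a < T z"
      \<comment> \<open>The sign of \<open>g\<close> locates \<open>T\<close> only for times in the
        window, hence the truncation of \<open>a\<close>; the sign at this fixed time persists for
        nearby states.\<close>
      define s where "s = max a (s0 - e)"
      have s: "s < T z" "\<bar>s - s0\<bar> \<le> e" using \<open>a < T z\<close> T(1)[OF z] unfolding s_def by auto
      have "\<forall>\<^sub>F y in nhds z. a < T y"
        using lt[OF conjunct1[OF near[OF z' s(2)]] iffD2[OF neg[OF z s(2)] s(1)]] nh
      proof eventually_elim
        case (elim y)
        then show ?case using neg[OF elim(2) s(2)] unfolding s_def by auto
      qed
      then show "\<forall>\<^sub>F y in at z. a < T y" by (simp add: eventually_nhds_conv_at)
    next
      fix a assume "a > T z"
      define s where "s = min a (s0 + e)"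
      have s: "s > T z" "\<bar>s - s0\<bar> \<le> e" using \<open>a > T z\<close> T(1)[OF z] unfolding s_def by auto
      then have "g (drift s z) > 0" using neg[OF z s(2)] zero[OF z s(2)] by auto
      from gt[OF conjunct1[OF near[OF z' s(2)]] this] nh have "\<forall>\<^sub>F y in nhds z. a > T y"
      proof eventually_elim
        case (elim y)
        then have "T y < s" using neg[of y s] zero[of y s] s(2) by auto
        then show ?case unfolding s_def by auto
      qed
      then show "\<forall>\<^sub>F y in at z. a > T y" by (simp add: eventually_nhds_conv_at)
    qed
  qed
  moreover have "drift s z \<in> U" "G (drift s z) \<bullet> snd z > 0" if "z \<in> ball z0 \<eta>" "\<bar>s - s0\<bar> \<le> e" for z s
    using near[of z s] that \<eta> by auto
  ultimately show thesis using e(1,2) \<eta>(1) T neg zero that by blast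
qed

section \<open>Structure of the interfaces\<close>

text \<open>The inclusion from right to left needs a curve in \<open>B\<close> with velocity
  \<open>v\<close>: the points \<open>x + t *\<^sub>R v\<close> are moved onto the level set in the
  fixed direction \<open>G x\<close>, by a hitting time near 0. As
  \<open>G x \<bullet> v = 0\<close>, this time has derivative 0 and the velocity remains
  \<open>v\<close>.\<close>

lemma tangent_space_level_set:
  fixes B :: "(real^'n) set"
  assumes U: "open U" and g: "\<And>y. y \<in> U \<Longrightarrow> (g has_derivative (\<lambda>h. G y \<bullet> h)) (at y)"
    and G: "continuous_on U G" and B: "B \<inter> U = {y \<in> U. g y = 0}"
    and x: "x \<in> B" "x \<in> U" and nz: "G x \<noteq> 0"
  shows "tangent_space B x = {v. G x \<bullet> v = 0}"
proof (intro equalityI subsetI; clarify)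
  fix v assume "v \<in> tangent_space B x"
  then obtain \<gamma> \<epsilon> where \<gamma>: "\<epsilon> > 0" "\<gamma> 0 = x" "\<And>t. t \<in> {-\<epsilon><..<\<epsilon>} \<Longrightarrow> \<gamma> t \<in> B"
    and d: "(\<gamma> has_vector_derivative v) (at 0)"
    unfolding tangent_space_def by auto
  have "(\<gamma> has_derivative (\<lambda>h. h *\<^sub>R v)) (at 0)" using d by (simp add: has_vector_derivative_def)
  from has_derivative_compose[OF this, of g, OF g] \<gamma>(2) x(2)
  have 1: "((\<lambda>t. g (\<gamma> t)) has_derivative (\<lambda>h. G x \<bullet> (h *\<^sub>R v))) (at 0)" by simp
  have "isCont \<gamma> 0" using d by (rule has_vector_derivative_continuous)
  then have "\<forall>\<^sub>F t in at 0. \<gamma> t \<in> U"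
    unfolding isCont_def \<gamma>(2) using topological_tendstoD U x(2) by blast
  moreover have "\<forall>\<^sub>F t in at 0. t \<in> {-\<epsilon><..<\<epsilon>}"
    using \<gamma>(1) by (intro eventually_at_in_open') auto
  ultimately have "\<forall>\<^sub>F t in at 0. g (\<gamma> t) = 0"
    by eventually_elim (use \<gamma>(3) B in blast)
  then have "((\<lambda>t. 0) has_derivative (\<lambda>h. G x \<bullet> (h *\<^sub>R v))) (at 0)"
    using 1 B \<gamma>(2) x by (intro has_derivative_transform_eventually[OF 1]) auto
  then have "(\<lambda>h::real. G x \<bullet> (h *\<^sub>R v)) = (\<lambda>h. 0)"
    by (rule has_derivative_unique) (rule has_derivative_const)
  from fun_cong[OF this, of 1] show "G x \<bullet> v = 0" by simp
next
  fix v assume v: "G x \<bullet> v = 0"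
  have gx: "g x = 0" using x B by auto
  have d0: "drift 0 (x, G x) = x" by (simp add: drift_def)
  obtain e \<eta> T where \<eta>: "0 < (\<eta>::real)" and T0: "T (x, G x) = (0::real)" and e: "e > 0"
    and inU: "\<And>z s. z \<in> ball (x, G x) \<eta> \<Longrightarrow> \<bar>s - 0\<bar> \<le> e \<Longrightarrow> drift s z \<in> U"
    and Te: "\<And>z. z \<in> ball (x, G x) \<eta> \<Longrightarrow> \<bar>T z - 0\<bar> < e"
    and zero: "\<And>z s. z \<in> ball (x, G x) \<eta> \<Longrightarrow> \<bar>s - 0\<bar> \<le> e \<Longrightarrow> g (drift s z) = 0 \<longleftrightarrow> s = T z"
    and der: "\<And>z. z \<in> ball (x, G x) \<eta> \<Longrightarrow> (T has_derivative
        (\<lambda>h. - (G (drift (T z) z) \<bullet> drift (T z) h) / (G (drift (T z) z) \<bullet> snd z))) (at z)"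
    by (rule implicit_hitting_time[of U g G 0 "(x, G x)" 1, OF U g G])
       (use x nz gx d0 in auto)
  define c where "c t = (x + t *\<^sub>R v, G x)" for t :: real
  define \<gamma> where "\<gamma> t = drift (T (c t)) (c t)" for t
  have c0: "c 0 = (x, G x)" by (simp add: c_def)
  have c: "c t \<in> ball (x, G x) \<eta>" if "\<bar>t\<bar> < \<eta> / (norm v + 1)" for t
  proof -
    have n: "norm v + 1 > 0" using norm_ge_zero[of v] by linarith
    have "\<bar>t\<bar> * norm v \<le> \<bar>t\<bar> * (norm v + 1)" by (simp add: mult_left_mono)
    also have "\<dots> < \<eta>" using that n by (simp add: pos_less_divide_eq)
    finally show ?thesis by (simp add: c_def dist_Pair_Pair dist_norm)
  qed
  have B\<gamma>: "\<gamma> t \<in> B" if "\<bar>t\<bar> < \<eta> / (norm v + 1)" for t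
    using inU[OF c[OF that], of "T (c t)"] Te[OF c[OF that]] zero[OF c[OF that], of "T (c t)"] B
    unfolding \<gamma>_def by auto
  have dc: "(c has_derivative (\<lambda>h. (h *\<^sub>R v, 0))) (at 0)"
    unfolding c_def by (rule derivative_eq_intros refl)+ simp
  have "(T has_derivative (\<lambda>h. - (G x \<bullet> drift 0 h) / (G x \<bullet> G x))) (at (c 0))"
    using der[of "(x, G x)"] \<eta> T0 d0 by (simp add: c0)
  from has_derivative_compose[OF dc this]
  have dT: "((\<lambda>t. T (c t)) has_derivative (\<lambda>h. 0)) (at 0)"
    using v by (simp add: drift_def)
  have "(\<gamma> has_derivative (\<lambda>h. h *\<^sub>R v)) (at 0)"
    unfolding \<gamma>_def drift_def
    by (rule derivative_eq_intros dT dc refl)+ (simp add: c0 T0)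
  then have "(\<gamma> has_vector_derivative v) (at 0)" by (simp add: has_vector_derivative_def)
  moreover have "\<gamma> 0 = x" using T0 d0 by (simp add: \<gamma>_def c0)
  moreover have "\<eta> / (norm v + 1) > 0" using \<eta> norm_ge_zero[of v] by (intro divide_pos_pos) linarith+
  ultimately show "v \<in> tangent_space B x"
    unfolding tangent_space_def using B\<gamma> by (intro CollectI exI[of _ \<gamma>] exI[of _ "\<eta> / (norm v + 1)"]) auto
qed

lemma interface_cases:
  assumes "x \<in> interfaces D M"
  obtains k l where "k \<in> {1..M}" "l \<in> {1..M}" "k \<noteq> l" "x \<in> closure (D k)" "x \<in> closure (D l)"
  using assms unfolding interfaces_def interface_def by (auto split: if_splits)

lemma interfacesI:
  assumes "k \<in> {1..M}" "l \<in> {1..M}" "k \<noteq> l" "x \<in> closure (D k)" "x \<in> closure (D l)"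
  shows "x \<in> interfaces D M"
proof -
  have "x \<in> interface D k l" using assms by (simp add: interface_def)
  then show ?thesis using assms(1,2) unfolding interfaces_def by blast
qed

lemma closed_interfaces: "closed (interfaces D M)"
  unfolding interfaces_def interface_def by (intro closed_UN) auto

lemma region_disjoint_closure:
  assumes "region_partition D M" "k \<in> {1..M}" "l \<in> {1..M}" "k \<noteq> l"
  shows "D k \<inter> closure (D l) = {}"
  using assms unfolding region_partition_def disjoint_family_on_def
  by (metis open_Int_closure_eq_empty)

lemma region_disjoint_interfaces:
  assumes "region_partition D M" "k \<in> {1..M}"
  shows "D k \<inter> interfaces D M = {}"
  using region_disjoint_closure[OF assms] by (blast elim: interface_cases)

text \<open>\<open>closure (D k)\<close> and the union of the other closures are closed sets that
  cover the space and meet only in interfaces. The conclusion is about the closure because points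
  off the interfaces need not belong to any region.\<close>

lemma connected_subset_region_closure:
  assumes part: "region_partition D M" and k: "k \<in> {1..M}"
    and C: "connected C" "C \<inter> interfaces D M = {}" and x: "x \<in> C" "x \<in> closure (D k)"
  shows "C \<subseteq> closure (D k)"
proof -
  define E where "E = (\<Union>l\<in>{1..M} - {k}. closure (D l))"
  have E: "closed E" unfolding E_def by (intro closed_UN) auto
  have cov: "C \<subseteq> closure (D k) \<union> E"
    using part k unfolding region_partition_def E_def by blast
  have "closure (D k) \<inter> E \<inter> C = {}"
    using C(2) interfacesI[OF k] unfolding E_def by blast
  then have "E \<inter> C = {}"
    using C(1) cov x E unfolding connected_closed by blast
  then show ?thesis using cov by blast
qed

text \<open>Transport along \<open>p0\<close> connects every point on one side of the interface to a ball off the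
  interface, so each side lies in the closure of one region.\<close>

lemma interface_local_structure:
  fixes D :: "nat \<Rightarrow> (real^'n) set"
  assumes part: "region_partition D M"
    and C1: "\<forall>k\<in>{1..M}. \<forall>l\<in>{1..M}. C1_hypersurface (interface D k l)"
    and i: "i \<in> {1..M}" and x0: "x0 \<in> interfaces D M"
    and uniq: "\<And>k l k' l'. k \<in> {1..M} \<Longrightarrow> l \<in> {1..M} \<Longrightarrow> k' \<in> {1..M} \<Longrightarrow> l' \<in> {1..M} \<Longrightarrow>
       x0 \<in> interface D k l \<inter> interface D k' l' \<Longrightarrow> {k, l} = {k', l'}"
    and arr: "arrives_from (D i) x0 p0"
    and trans: "\<And>k l. k \<in> {1..M} \<Longrightarrow> l \<in> {1..M} \<Longrightarrow> x0 \<in> interface D k l \<Longrightarrow>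
       p0 \<notin> tangent_space (interface D k l) x0"
  obtains j r g G where "j \<in> {1..M}" "r > 0"
    "\<And>y. y \<in> ball x0 r \<Longrightarrow> (g has_derivative (\<lambda>h. G y \<bullet> h)) (at y)"
    "continuous_on (ball x0 r) G" "G x0 \<bullet> p0 > 0" "g x0 = 0"
    "\<And>y. y \<in> ball x0 r \<Longrightarrow> y \<in> interfaces D M \<longleftrightarrow> g y = 0"
    "\<And>y. y \<in> ball x0 r \<Longrightarrow> g y < 0 \<Longrightarrow> y \<in> closure (D i)"
    "\<And>y. y \<in> ball x0 r \<Longrightarrow> y \<in> D i \<Longrightarrow> g y < 0"
    "\<And>y. y \<in> ball x0 r \<Longrightarrow> g y = 0 \<Longrightarrow> region_beyond D M i y = j"
    "\<And>y. y \<in> ball x0 r \<Longrightarrow> g y = 0 \<Longrightarrow> unit_normal D i j y = (1 / norm (G y)) *\<^sub>R G y"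
    "\<And>y. y \<in> ball x0 r \<Longrightarrow> G y \<noteq> 0"
proof -
  obtain \<epsilon>0 where \<epsilon>0: "\<epsilon>0 > 0" "\<And>s. 0 < s \<Longrightarrow> s < \<epsilon>0 \<Longrightarrow> x0 - s *\<^sub>R p0 \<in> closure (D i)"
    using arr unfolding arrives_from_def by auto
  have x0i: "x0 \<in> closure (D i)"
  proof (rule Lim_in_closed_set[of _ "\<lambda>s. x0 - s *\<^sub>R p0" "at_right 0"])
    show "\<forall>\<^sub>F s in at_right 0. x0 - s *\<^sub>R p0 \<in> closure (D i)"
      using \<epsilon>0 unfolding eventually_at_right_field by blast
    have "((\<lambda>s::real. x0 - s *\<^sub>R p0) \<longlongrightarrow> x0 - 0 *\<^sub>R p0) (at_right 0)"
      by (intro tendsto_intros)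
    then show "((\<lambda>s::real. x0 - s *\<^sub>R p0) \<longlongrightarrow> x0) (at_right 0)" by simp
  qed auto
  obtain j where j: "j \<in> {1..M}" "j \<noteq> i" "x0 \<in> closure (D j)"
    using interface_cases[OF x0] by metis
  have x0B: "x0 \<in> interface D i j" using j x0i by (simp add: interface_def)
  \<comment> \<open>By Condition 1: a third region at \<open>x0\<close> would put \<open>x0\<close>
    on two interfaces with different index pairs.\<close>
  have only: "k = i \<or> k = j" if "k \<in> {1..M}" "x0 \<in> closure (D k)" for k
  proof (cases "k = i")
    case False
    then have "x0 \<in> interface D i k" using that x0i by (simp add: interface_def)
    then have "{i, k} = {i, j}" using uniq[OF i that(1) i j(1)] x0B by blast
    then show ?thesis by blast
  qed simp
  have "C1_hypersurface (interface D i j)" using C1 i j(1) by blast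
  from this[unfolded C1_hypersurface_def, THEN bspec, OF x0B]
  obtain U0 g1 G1 where "open U0 \<and> x0 \<in> U0 \<and>
        (\<forall>y\<in>U0. (g1 has_derivative (\<lambda>h. G1 y \<bullet> h)) (at y)) \<and> continuous_on U0 G1 \<and>
        (\<forall>y\<in>U0. G1 y \<noteq> 0) \<and> interface D i j \<inter> U0 = {y \<in> U0. g1 y = (0::real)}"
    by (elim exE)
  then have U0: "open U0" "x0 \<in> U0" "\<And>y. y \<in> U0 \<Longrightarrow> (g1 has_derivative (\<lambda>h. G1 y \<bullet> h)) (at y)"
    "continuous_on U0 G1" "\<And>y. y \<in> U0 \<Longrightarrow> G1 y \<noteq> 0" "interface D i j \<inter> U0 = {y \<in> U0. g1 y = (0::real)}"
    by blast+
  have "G1 x0 \<bullet> p0 \<noteq> 0"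
  proof -
    have "tangent_space (interface D i j) x0 = {v. G1 x0 \<bullet> v = 0}"
      by (rule tangent_space_level_set[of U0 g1 G1]) (use U0 x0B in auto)
    then show ?thesis using trans[OF i j(1) x0B] by simp
  qed
  \<comment> \<open>The sign makes the defining function increase along \<open>p0\<close>, so that
    \<open>g < 0\<close> is the side of arrival.\<close>
  define \<sigma> where "\<sigma> = sgn (G1 x0 \<bullet> p0)"
  have \<sigma>: "\<sigma> \<noteq> 0" "\<sigma> * (G1 x0 \<bullet> p0) > 0"
    using \<open>G1 x0 \<bullet> p0 \<noteq> 0\<close> unfolding \<sigma>_def by (auto simp: sgn_if)
  define g where "g y = \<sigma> * g1 y" for y
  define G where "G y = \<sigma> *\<^sub>R G1 y" for y
  \<comment> \<open>None of these finitely many closures contains \<open>x0\<close>; once they are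
    removed, \<open>interface D i j\<close> is, up to the order of indices, the only interface in
    \<open>U\<close>.\<close>
  define F where "F = (\<Union>k\<in>{1..M} - {i, j}. closure (D k))"
  define U where "U = U0 - F"
  have "closed F" unfolding F_def by (intro closed_UN) auto
  then have U: "open U" unfolding U_def using U0(1) by blast
  have x0U: "x0 \<in> U" using only U0(2) unfolding U_def F_def by blast
  have g: "(g has_derivative (\<lambda>h. G y \<bullet> h)) (at y)" if "y \<in> U" for y
    using has_derivative_mult_right[OF U0(3), of y \<sigma>] that unfolding g_def G_def U_def by simp
  have G: "continuous_on U G"
    unfolding G_def U_def by (intro continuous_intros continuous_on_subset[OF U0(4)]) auto
  have Bij: "interface D i j \<inter> U = {y \<in> U. g y = 0}"
    using U0(6) \<sigma>(1) unfolding U_def g_def by auto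
  have intf: "y \<in> interfaces D M \<longleftrightarrow> g y = 0" if y: "y \<in> U" for y
  proof
    assume "y \<in> interfaces D M"
    then obtain k l where "k \<in> {1..M}" "l \<in> {1..M}" "k \<noteq> l" "y \<in> closure (D k)" "y \<in> closure (D l)"
      by (rule interface_cases)
    moreover from this y have "k \<in> {i, j}" "l \<in> {i, j}" unfolding U_def F_def by auto
    ultimately have "y \<in> interface D i j" by (auto simp: interface_def)
    then show "g y = 0" using y Bij by blast
  next
    assume "g y = 0"
    then have "y \<in> interface D i j" using y Bij by blast
    then show "y \<in> interfaces D M" using i j(1) unfolding interfaces_def by blast
  qed
  have gx0: "g x0 = 0" using x0U x0 intf by blast
  have Gp0: "G x0 \<bullet> p0 > 0" using \<sigma> unfolding G_def by simp

  \<comment> \<open>Transport along \<open>p0\<close> and the two sides of the interface\<close>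
  have d0: "drift 0 (y, p) = y" for y p :: "real^'n" by (simp add: drift_def)
  obtain e \<eta> T where \<eta>: "0 < (\<eta>::real)" and T0: "T (x0, p0) = (0::real)" and e: "e > 0"
    and inU': "\<And>z s. z \<in> ball (x0, p0) \<eta> \<Longrightarrow> \<bar>s - 0\<bar> \<le> e \<Longrightarrow> drift s z \<in> U"
    and Gp': "\<And>z s. z \<in> ball (x0, p0) \<eta> \<Longrightarrow> \<bar>s - 0\<bar> \<le> e \<Longrightarrow> G (drift s z) \<bullet> snd z > 0"
    and Te': "\<And>z. z \<in> ball (x0, p0) \<eta> \<Longrightarrow> \<bar>T z - 0\<bar> < e"
    and neg': "\<And>z s. z \<in> ball (x0, p0) \<eta> \<Longrightarrow> \<bar>s - 0\<bar> \<le> e \<Longrightarrow> g (drift s z) < 0 \<longleftrightarrow> s < T z"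
    and zero': "\<And>z s. z \<in> ball (x0, p0) \<eta> \<Longrightarrow> \<bar>s - 0\<bar> \<le> e \<Longrightarrow> g (drift s z) = 0 \<longleftrightarrow> s = T z"
    by (rule implicit_hitting_time[of U g G 0 "(x0, p0)" 1, OF U g G])
       (use x0U gx0 Gp0 in \<open>auto simp: d0\<close>)
  have lift: "(y, p0) \<in> ball (x0, p0) \<eta>" if "y \<in> ball x0 \<eta>" for y
    using that by (simp add: dist_Pair_Pair)
  define m where "m y s = y + s *\<^sub>R p0" for y s
  define T1 where "T1 y = T (y, p0)" for y
  have inU: "m y s \<in> U" if "y \<in> ball x0 \<eta>" "\<bar>s\<bar> \<le> e" for y s
    using inU'[OF lift[OF that(1)], of s] that by (simp add: drift_def m_def)
  have Te: "\<bar>T1 y\<bar> < e" if "y \<in> ball x0 \<eta>" for y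
    using Te'[OF lift[OF that(1)]] by (simp add: T1_def)
  have neg: "g (m y s) < 0 \<longleftrightarrow> s < T1 y" and zero: "g (m y s) = 0 \<longleftrightarrow> s = T1 y"
    if "y \<in> ball x0 \<eta>" "\<bar>s\<bar> \<le> e" for y s
    using neg'[OF lift[OF that(1)], of s] zero'[OF lift[OF that(1)], of s] that
    by (auto simp add: drift_def m_def T1_def)
  have pos: "g (m y s) > 0 \<longleftrightarrow> s > T1 y" if "y \<in> ball x0 \<eta>" "\<bar>s\<bar> \<le> e" for y s
    using neg[OF that] zero[OF that] by linarith
  have m0: "m y 0 = y" for y by (simp add: m_def)
  have bU: "y \<in> U" if "y \<in> ball x0 \<eta>" for y using inU[OF that, of 0] e by (simp add: m_def)
  have off: "m y s \<notin> interfaces D M" if "y \<in> ball x0 \<eta>" "\<bar>s\<bar> \<le> e" "s \<noteq> T1 y" for y s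
    using intf[OF inU[OF that(1,2)]] zero[OF that(1,2)] that by blast
  have seg: "m y ` {a..b} \<subseteq> closure (D k)"
    if y: "y \<in> ball x0 \<eta>" and k: "k \<in> {1..M}" and ab: "- e \<le> a" "b \<le> e" "T1 y \<notin> {a..b}"
      and s: "s \<in> {a..b}" "m y s \<in> closure (D k)" for y k a b s
  proof (rule connected_subset_region_closure[OF part k _ _ _ s(2)])
    have "continuous_on {a..b} (m y)" unfolding m_def by (intro continuous_intros)
    then show "connected (m y ` {a..b})" by (intro connected_continuous_image) auto
    show "m y ` {a..b} \<inter> interfaces D M = {}" using off[OF y] ab by force
    show "m y s \<in> m y ` {a..b}" using s by blast
  qed
  \<comment> \<open>At the times \<open>e\<close> and \<open>- e\<close> no point of the ball is on
    an interface, as \<open>\<bar>T1 y\<bar> < e\<close>. The translated ball is connected, hence in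
    the closure of one region; this links different points of the same side.\<close>
  have far: "ball (m x0 s) \<eta> \<subseteq> closure (D k)" if "\<bar>s\<bar> = e" and k: "k \<in> {1..M}" and y: "y \<in> ball x0 \<eta>"
    and yk: "m y s \<in> closure (D k)" for s k y
  proof (rule connected_subset_region_closure[OF part k _ _ _ yk])
    show "ball (m x0 s) \<eta> \<inter> interfaces D M = {}"
    proof (rule equals0I)
      fix z assume z: "z \<in> ball (m x0 s) \<eta> \<inter> interfaces D M"
      have b: "z - s *\<^sub>R p0 \<in> ball x0 \<eta>" using z by (auto simp: m_def dist_norm algebra_simps)
      then have "s \<noteq> T1 (z - s *\<^sub>R p0)" using Te[OF b] that(1) by auto
      then have "m (z - s *\<^sub>R p0) s \<notin> interfaces D M" using b that(1) by (intro off) auto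
      then show False using z by (simp add: m_def)
    qed
    show "m y s \<in> ball (m x0 s) \<eta>" using y by (simp add: m_def)
  qed auto
  have shift: "m y' s \<in> closure (D k)"
    if "\<bar>s\<bar> = e" "k \<in> {1..M}" "y \<in> ball x0 \<eta>" "m y s \<in> closure (D k)" "y' \<in> ball x0 \<eta>" for s k y y'
  proof -
    have "m y' s \<in> ball (m x0 s) \<eta>" using that(5) by (simp add: m_def)
    then show ?thesis using far[OF that(1-4)] by blast
  qed
  have sideneg: "y \<in> closure (D k)" if k: "k \<in> {1..M}" and y1: "y1 \<in> ball x0 \<eta>" "g y1 < 0" "y1 \<in> closure (D k)"
    and y: "y \<in> ball x0 \<eta>" "g y < 0" for k y y1
  proof -
    have T: "T1 y1 > 0" "T1 y > 0" using neg[OF y1(1), of 0] neg[OF y(1), of 0] y y1 e by (auto simp: m_def)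
    have "m y1 (- e) \<in> closure (D k)"
      using seg[OF y1(1) k, of "- e" 0 0] T e y1 by (auto simp: m0)
    then have "m y (- e) \<in> closure (D k)" using shift[OF _ k y1(1) _ y(1)] e by simp
    then have "m y 0 \<in> closure (D k)" using seg[OF y(1) k, of "- e" 0 "- e"] T e by auto
    then show ?thesis by (simp add: m0)
  qed
  have sidepos: "y \<in> closure (D k)" if k: "k \<in> {1..M}" and y1: "y1 \<in> ball x0 \<eta>" "g y1 > 0" "y1 \<in> closure (D k)"
    and y: "y \<in> ball x0 \<eta>" "g y > 0" for k y y1
  proof -
    have T: "T1 y1 < 0" "T1 y < 0" using pos[OF y1(1), of 0] pos[OF y(1), of 0] y y1 e by (auto simp: m_def)
    have "m y1 e \<in> closure (D k)"
      using seg[OF y1(1) k, of 0 e 0] T e y1 by (auto simp: m0)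
    then have "m y e \<in> closure (D k)" using shift[OF _ k y1(1) _ y(1)] e by simp
    then have "m y 0 \<in> closure (D k)" using seg[OF y(1) k, of 0 e e] T e by auto
    then show ?thesis by (simp add: m0)
  qed
  \<comment> \<open>Small enough that \<open>x0 - s1 *\<^sub>R p0\<close> is in
    \<open>closure (D i)\<close> by the arrival condition and within \<open>\<eta>\<close> of
    \<open>x0\<close>, with \<open>s1\<close> in the window. This point identifies the negative
    side.\<close>
  define s1 where "s1 = min (min (\<epsilon>0 / 2) e) (\<eta> / (2 * (norm p0 + 1)))"
  have n: "norm p0 + 1 > 0" using norm_ge_zero[of p0] by linarith
  have s1: "0 < s1" "s1 < \<epsilon>0" "s1 \<le> e" using \<epsilon>0(1) e \<eta> n unfolding s1_def by auto
  have "s1 \<le> \<eta> / (2 * (norm p0 + 1))" unfolding s1_def by (rule min.cobounded2)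
  then have "s1 * norm p0 + s1 \<le> \<eta> / 2" using n by (simp add: field_simps)
  then have "s1 * norm p0 < \<eta>" using \<eta> s1 by linarith
  then have y1: "x0 - s1 *\<^sub>R p0 \<in> ball x0 \<eta>" using s1 by (simp add: dist_norm)
  have "g (m x0 (- s1)) < 0" using neg[of x0 "- s1"] \<eta> s1 T0 by (simp add: T1_def)
  then have negi: "y \<in> closure (D i)" if "y \<in> ball x0 \<eta>" "g y < 0" for y
    using sideneg[OF i y1 _ \<epsilon>0(2)[OF s1(1,2)] that] by (simp add: m_def)
  \<comment> \<open>\<open>D j\<close> accumulates at \<open>x0\<close>, but not from the negative
    side: that side is in \<open>closure (D i)\<close>, which does not meet the open set
    \<open>D j\<close>.\<close>
  obtain y2 where y2: "y2 \<in> D j" "y2 \<in> ball x0 \<eta>"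
    using j(3) \<eta> unfolding closure_approachable by (auto simp: dist_commute)
  have "g y2 \<noteq> 0" using intf[OF bU[OF y2(2)]] y2 region_disjoint_interfaces[OF part j(1)] by blast
  moreover have "\<not> g y2 < 0" using negi[OF y2(2)] region_disjoint_closure[OF part j(1) i j(2)] y2 by blast
  ultimately have "g y2 > 0" by linarith
  then have posj: "y \<in> closure (D j)" if "y \<in> ball x0 \<eta>" "g y > 0" for y
    using sidepos[OF j(1) y2(2) _ _ that] y2 closure_subset[of "D j"] by blast
  have Dneg: "g y < 0" if y: "y \<in> ball x0 \<eta>" "y \<in> D i" for y
  proof -
    have "g y \<noteq> 0" using intf[OF bU[OF y(1)]] y region_disjoint_interfaces[OF part i] by blast
    moreover have "\<not> g y > 0" using posj[OF y(1)] region_disjoint_closure[OF part i j(1)] j(2) y by blast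
    ultimately show ?thesis by linarith
  qed

  \<comment> \<open>The region beyond and the unit normal\<close>
  have Gnz: "G y \<noteq> 0" if "y \<in> ball x0 \<eta>" for y
    using Gp'[OF lift[OF that], of 0] e by (auto simp: d0)
  have beyond: "region_beyond D M i y = j" if y: "y \<in> ball x0 \<eta>" "g y = 0" for y
    unfolding region_beyond_def
  proof (rule the_equality)
    show "j \<in> {1..M} \<and> y \<in> interface D i j" using j(1) Bij bU y by blast
    show "k = j" if "k \<in> {1..M} \<and> y \<in> interface D i k" for k
      using that bU[OF y(1)] unfolding interface_def U_def F_def by (auto split: if_splits)
  qed
  have normal: "unit_normal D i j y = (1 / norm (G y)) *\<^sub>R G y" if y: "y \<in> ball x0 \<eta>" "g y = 0" for y
  proof -
    define \<nu> where "\<nu> = (1 / norm (G y)) *\<^sub>R G y"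
    have G\<nu>: "G y = norm (G y) *\<^sub>R \<nu>" using Gnz[OF y(1)] by (simp add: \<nu>_def)
    have n1: "norm \<nu> = 1" using Gnz[OF y(1)] by (simp add: \<nu>_def)
    have yB: "y \<in> interface D i j" using Bij bU y by blast
    have tan: "tangent_space (interface D i j) y = {v. \<nu> \<bullet> v = 0}"
      using tangent_space_level_set[OF U g G Bij yB bU[OF y(1)] Gnz[OF y(1)]] Gnz[OF y(1)]
      by (simp add: \<nu>_def)
    have "((\<lambda>s. y + s *\<^sub>R \<nu>) has_derivative (\<lambda>h. h *\<^sub>R \<nu>)) (at (0::real))"
      by (auto intro!: derivative_eq_intros)
    from has_derivative_compose[OF this, of g, OF g] bU[OF y(1)]
    have "((\<lambda>s. g (y + s *\<^sub>R \<nu>)) has_derivative (\<lambda>h. G y \<bullet> (h *\<^sub>R \<nu>))) (at 0)" by simp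
    then have D: "DERIV (\<lambda>s. g (y + s *\<^sub>R \<nu>)) 0 :> G y \<bullet> \<nu>"
      by (rule has_derivative_imp_has_field_derivative) simp
    have Gp: "G y \<bullet> \<nu> > 0" using n1 Gnz[OF y(1)] by (subst G\<nu>) (simp add: dot_square_norm)
    obtain d1 where d1: "d1 > 0" "\<And>s. s > 0 \<Longrightarrow> s < d1 \<Longrightarrow> 0 < g (y + s *\<^sub>R \<nu>)"
      using DERIV_pos_inc_right[OF D Gp] y(2) by auto
    obtain d2 where d2: "d2 > 0" "\<And>s. s > 0 \<Longrightarrow> s < d2 \<Longrightarrow> g (y - s *\<^sub>R \<nu>) < 0"
      using DERIV_pos_inc_left[OF D Gp] y(2) by auto
    obtain d3 where d3: "d3 > 0" "ball y d3 \<subseteq> ball x0 \<eta>"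
      using y(1) open_ball open_contains_ball by blast
    define \<epsilon> where "\<epsilon> = min (min d1 d2) d3"
    have \<epsilon>: "\<epsilon> > 0" using d1 d2 d3 unfolding \<epsilon>_def by simp
    have bl: "y + s *\<^sub>R \<nu> \<in> ball x0 \<eta>" "y - s *\<^sub>R \<nu> \<in> ball x0 \<eta>" if "0 < s" "s < \<epsilon>" for s
      using that n1 d3(2) unfolding \<epsilon>_def by (auto simp: dist_norm subset_iff)
    have sides: "y - s *\<^sub>R \<nu> \<in> closure (D i)" "y + s *\<^sub>R \<nu> \<in> closure (D j)" if "0 < s" "s < \<epsilon>" for s
      using bl[OF that] d1(2)[of s] d2(2)[of s] that negi posj unfolding \<epsilon>_def by auto
    show ?thesis
      unfolding unit_normal_def \<nu>_def[symmetric]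
    proof (rule the_equality)
      show "norm \<nu> = 1 \<and> (\<forall>v\<in>tangent_space (interface D i j) y. \<nu> \<bullet> v = 0) \<and>
        (\<exists>\<epsilon>>0. \<forall>s\<in>{0<..<\<epsilon>}. y - s *\<^sub>R \<nu> \<in> closure (D i) \<and> y + s *\<^sub>R \<nu> \<in> closure (D j))"
        using n1 tan sides \<epsilon> by auto
      fix n assume n: "norm n = 1 \<and> (\<forall>v\<in>tangent_space (interface D i j) y. n \<bullet> v = 0) \<and>
        (\<exists>\<epsilon>>0. \<forall>s\<in>{0<..<\<epsilon>}. y - s *\<^sub>R n \<in> closure (D i) \<and> y + s *\<^sub>R n \<in> closure (D j))"
      define v where "v = n - (\<nu> \<bullet> n) *\<^sub>R \<nu>"
      have \<nu>v: "\<nu> \<bullet> v = 0" using n1 by (simp add: v_def inner_diff_right dot_square_norm)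
      then have "n \<bullet> v = 0" using n tan by blast
      then have "v \<bullet> v = 0" using \<nu>v by (simp add: v_def inner_diff_left)
      then have nv: "n = (\<nu> \<bullet> n) *\<^sub>R \<nu>" by (simp add: v_def)
      then have "\<bar>\<nu> \<bullet> n\<bar> = 1" using n n1 by (metis mult.right_neutral norm_scaleR)
      \<comment> \<open>For the opposite normal, \<open>y + s *\<^sub>R \<nu>\<close> with small
        \<open>s > 0\<close> would lie in both closures, hence on an interface, against
        \<open>g > 0\<close> there.\<close>
      moreover have "\<nu> \<bullet> n \<noteq> - 1"
      proof
        assume "\<nu> \<bullet> n = - 1"
        then have n: "n = - \<nu>" using nv by simp
        obtain \<epsilon>' where \<epsilon>': "\<epsilon>' > 0" "\<And>s. 0 < s \<Longrightarrow> s < \<epsilon>' \<Longrightarrow> y + s *\<^sub>R \<nu> \<in> closure (D i)"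
          using \<open>norm n = 1 \<and> _\<close> n by auto
        define s where "s = min \<epsilon> \<epsilon>' / 2"
        have s: "0 < s" "s < \<epsilon>" "s < \<epsilon>'" using \<epsilon> \<epsilon>' unfolding s_def by auto
        have "y + s *\<^sub>R \<nu> \<in> interfaces D M"
          using interfacesI[OF i j(1)] j(2) \<epsilon>'(2)[of s] sides(2)[of s] s by blast
        then have "g (y + s *\<^sub>R \<nu>) = 0" using intf bU bl(1)[of s] s by blast
        then show False using d1(2)[of s] s unfolding \<epsilon>_def by simp
      qed
      ultimately show "n = \<nu>" using nv by (metis abs_eq_iff' scaleR_one)
    qed
  qed
  have "(g has_derivative (\<lambda>h. G y \<bullet> h)) (at y)" if "y \<in> ball x0 \<eta>" for y using g bU that by blast
  moreover have "continuous_on (ball x0 \<eta>) G" using G bU by (blast intro: continuous_on_subset)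
  moreover have "y \<in> interfaces D M \<longleftrightarrow> g y = 0" if "y \<in> ball x0 \<eta>" for y using intf bU that by blast
  ultimately show thesis
    using that[of j \<eta> g G] j(1) \<eta> Gp0 gx0 negi Dneg beyond normal Gnz by blast
qed

section \<open>Symplecticity of an impact\<close>

text \<open>Reflection and refraction enter only through \<open>kick\<close> and
  \<open>energy\<close>, a jump along the normal and a locally constant change of the squared
  momentum. \<open>sec\<close> provides the states that hit at time \<open>s0\<close> exactly with
  momentum \<open>p0\<close>, and \<open>cone\<close> the half-space of directions that determines
  derivatives within \<open>S\<close>.\<close>

lemma impact_map_symplectic:
  fixes F :: "'a::euclidean_space \<times> 'a \<Rightarrow> 'a \<times> 'a" and g :: "'a \<Rightarrow> real"
    and q0 p0 :: 'a and s0 :: real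
  defines "x0 \<equiv> drift s0 (q0, p0)"
  assumes F: "(F has_derivative F') (at (q0, p0) within S)" and zS: "(q0, p0) \<in> S"
    and G: "isCont G x0" "G x0 \<bullet> p0 > 0"
    and \<eta>: "\<eta> > 0" and T0: "T (q0, p0) = s0" and e: "e > 0"
    and Te: "\<And>z. z \<in> ball (q0, p0) \<eta> \<Longrightarrow> \<bar>T z - s0\<bar> < e"
    and Gp: "\<And>z s. z \<in> ball (q0, p0) \<eta> \<Longrightarrow> \<bar>s - s0\<bar> \<le> e \<Longrightarrow> G (drift s z) \<bullet> snd z > 0"
    and zero: "\<And>z s. z \<in> ball (q0, p0) \<eta> \<Longrightarrow> \<bar>s - s0\<bar> \<le> e \<Longrightarrow> g (drift s z) = 0 \<longleftrightarrow> s = T z"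
    and dT: "\<And>z. z \<in> ball (q0, p0) \<eta> \<Longrightarrow> (T has_derivative
        (\<lambda>h. - (G (drift (T z) z) \<bullet> drift (T z) h) / (G (drift (T z) z) \<bullet> snd z))) (at z)"
    and sec: "\<And>y. y \<in> ball x0 \<eta> \<Longrightarrow> g y = 0 \<Longrightarrow> (y - s0 *\<^sub>R p0, p0) \<in> S"
    and pos: "\<And>z. z \<in> S \<Longrightarrow> z \<in> ball (q0, p0) \<eta> \<Longrightarrow>
        fst (F z) = drift (T z) z + (\<delta> - T z) *\<^sub>R snd (F z)"
    and kick: "\<And>z. z \<in> S \<Longrightarrow> z \<in> ball (q0, p0) \<eta> \<Longrightarrow>
        \<exists>c. snd (F z) - snd z = c *\<^sub>R G (drift (T z) z)"
    and energy: "\<And>z. z \<in> S \<Longrightarrow> z \<in> ball (q0, p0) \<eta> \<Longrightarrow> snd (F z) \<bullet> snd (F z) = snd z \<bullet> snd z + E"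
    and l: "linear l" "l b > (0::real)"
    and cone: "\<And>h e. l h > 0 \<Longrightarrow> e > 0 \<Longrightarrow>
        \<exists>t\<in>{0<..<e}. \<exists>x\<in>S. norm (x - (q0, p0) - t *\<^sub>R h) \<le> e * t"
  shows "fst (F' h) \<bullet> snd (F' k) - snd (F' h) \<bullet> fst (F' k) = fst h \<bullet> snd k - snd h \<bullet> fst k"
proof -
  define z0 where "z0 = (q0, p0)"
  note F = F[folded z0_def] and zS = zS[folded z0_def] and T0 = T0[folded z0_def]
    and Te = Te[folded z0_def] and Gp = Gp[folded z0_def] and zero = zero[folded z0_def]
    and dT = dT[folded z0_def] and pos = pos[folded z0_def] and kick = kick[folded z0_def]
    and energy = energy[folded z0_def] and cone = cone[folded z0_def]
  have z0: "fst z0 = q0" "snd z0 = p0" "drift s0 z0 = x0" by (auto simp: z0_def x0_def)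
  have z0b: "z0 \<in> ball z0 \<eta>" using \<eta> by simp
  note unique = has_derivative_within_zero_unique[OF _ l cone]
  define x where "x z = drift (T z) z" for z
  define G0 where "G0 = G x0"
  define T' where "T' h = - (G0 \<bullet> drift s0 h) / (G0 \<bullet> p0)" for h
  define x' where "x' h = drift s0 h + T' h *\<^sub>R p0" for h
  have xz0: "x z0 = x0" by (simp add: x_def T0 z0)
  have T': "(T has_derivative T') (at z0)"
    using dT[OF z0b] unfolding T0 z0 T'_def[abs_def] G0_def by simp
  have x': "(x has_derivative x') (at z0)"
    unfolding x_def drift_def
    by (rule derivative_eq_intros T' refl)+ (auto simp: x'_def drift_def T0 z0 fun_eq_iff)
  have G0x': "G0 \<bullet> x' h = 0" for h
    using G(2) by (simp add: x'_def T'_def inner_diff_right G0_def)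
  have gx: "g (x z) = 0" if "z \<in> ball z0 \<eta>" for z
    using zero[OF that, of "T z"] Te[OF that] by (simp add: x_def)

  have xc: "(x \<longlongrightarrow> x0) (nhds z0)"
    using isCont_tendsto_nhds[OF has_derivative_continuous[OF x']] xz0 by simp
  have "\<forall>\<^sub>F z in nhds z0. z \<in> ball z0 \<eta> \<and> x z \<in> ball x0 \<eta>"
    using topological_tendstoD[OF xc, of "ball x0 \<eta>"] \<eta> z0b
    by (intro eventually_conj eventually_nhds_in_open) auto
  then have evS: "\<forall>\<^sub>F z in at z0 within S. z \<in> S \<and> z \<in> ball z0 \<eta> \<and> x z \<in> ball x0 \<eta>"
    unfolding eventually_at_filter by eventually_elim blast
  have x0S: "z0 \<in> S" "z0 \<in> ball z0 \<eta>" "x z0 \<in> ball x0 \<eta>" using zS z0b xz0 \<eta> by auto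

  \<comment> \<open>Projection onto the interface along \<open>p0\<close>\<close>
  define \<sigma> where "\<sigma> u = (u - s0 *\<^sub>R p0, p0)" for u
  have \<sigma>b: "\<sigma> u \<in> ball z0 \<eta> \<longleftrightarrow> u \<in> ball x0 \<eta>" for u
  proof -
    have "\<sigma> u - z0 = (u - x0, 0)" by (simp add: \<sigma>_def z0_def x0_def drift_def algebra_simps)
    then have "norm (\<sigma> u - z0) = norm (u - x0)" by (simp add: norm_Pair)
    then show ?thesis by (simp add: dist_norm norm_minus_commute)
  qed
  have d\<sigma>: "drift s (\<sigma> u) = u + (s - s0) *\<^sub>R p0" for s u by (simp add: drift_def \<sigma>_def algebra_simps)
  define Y where "Y u = x (\<sigma> u)" for u
  have \<sigma>x0: "\<sigma> x0 = z0" by (simp add: \<sigma>_def z0_def x0_def drift_def)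
  have Yx0: "Y x0 = x0" by (simp add: Y_def \<sigma>x0 xz0)
  have T\<sigma>: "T (\<sigma> y) = s0" if "y \<in> ball x0 \<eta>" "g y = 0" for y
    using zero[of "\<sigma> y" s0] that e \<sigma>b by (simp add: d\<sigma>)
  have Y_id: "Y y = y" if "y \<in> ball x0 \<eta>" "g y = 0" for y
    using T\<sigma>[OF that] by (simp add: Y_def x_def d\<sigma>)
  define N where "N u = (- 1 / (G (Y u) \<bullet> p0)) *\<^sub>R G (Y u)" for u
  have \<sigma>': "(\<sigma> has_derivative (\<lambda>h. (h, 0))) (at u)" for u
    unfolding \<sigma>_def by (auto intro!: derivative_eq_intros)
  have gradN: "((\<lambda>u. T (\<sigma> u)) has_derivative (\<lambda>h. N u \<bullet> h)) (at u)" if "u \<in> ball x0 \<eta>" for u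
  proof -
    have "\<sigma> u \<in> ball z0 \<eta>" using that \<sigma>b by blast
    from has_derivative_compose[OF \<sigma>' dT[OF this]]
    show ?thesis by (simp add: N_def Y_def x_def drift_def \<sigma>_def)
  qed
  have "(x has_derivative x') (at (\<sigma> x0))" using x' by (simp add: \<sigma>x0)
  from has_derivative_compose[OF \<sigma>' this]
  have Y': "(Y has_derivative (\<lambda>h. x' (h, 0))) (at x0)" by (simp add: Y_def[abs_def])
  have gY: "g (Y u) = 0" if "u \<in> ball x0 \<eta>" for u using gx \<sigma>b that unfolding Y_def by blast
  have Yc: "(Y \<longlongrightarrow> x0) (nhds x0)"
    using isCont_tendsto_nhds[OF has_derivative_continuous[OF Y']] Yx0 by simp
  have ev: "\<forall>\<^sub>F u in nhds x0. u \<in> ball x0 \<eta> \<and> Y u \<in> ball x0 \<eta>"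
    using Yc topological_tendstoD[OF Yc, of "ball x0 \<eta>"] \<eta>
    by (intro eventually_conj eventually_nhds_in_open) auto
  then obtain r where r: "r > 0" "\<And>u. u \<in> ball x0 r \<Longrightarrow> u \<in> ball x0 \<eta> \<and> Y u \<in> ball x0 \<eta>"
    unfolding eventually_nhds_metric by (auto simp: dist_commute)
  define P' where "P' h = snd (F' h)" for h
  have P': "((\<lambda>z. snd (F z)) has_derivative P') (at z0 within S)"
    unfolding P'_def using F by (rule has_derivative_snd)
  define w where "w z = snd (F z) - snd z" for z
  define w' where "w' h = P' h - snd h" for h
  have w': "(w has_derivative w') (at z0 within S)"
    unfolding w_def w'_def by (intro derivative_intros P')
  \<comment> \<open>\<open>\<sigma> (Y u)\<close> is in \<open>S\<close> for every \<open>u\<close>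
    near \<open>x0\<close>, so \<open>W\<close> has a two-sided derivative although \<open>w\<close>
    is only differentiable within \<open>S\<close>.\<close>
  define W where "W u = w (\<sigma> (Y u))" for u
  have \<sigma>Y: "\<sigma> (Y u) \<in> S" "\<sigma> (Y u) \<in> ball z0 \<eta>" "x (\<sigma> (Y u)) = Y u" if "u \<in> ball x0 r" for u
  proof -
    have b: "Y u \<in> ball x0 \<eta>" "g (Y u) = 0" using r(2) gY that by auto
    show "\<sigma> (Y u) \<in> S" using sec[OF b] by (simp add: \<sigma>_def)
    show "\<sigma> (Y u) \<in> ball z0 \<eta>" using b \<sigma>b by blast
    show "x (\<sigma> (Y u)) = Y u" using Y_id[OF b] by (simp add: Y_def)
  qed
  have "((\<lambda>u. \<sigma> (Y u)) has_derivative (\<lambda>h. (x' (h, 0), 0))) (at x0)"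
    using has_derivative_compose[OF Y' \<sigma>'] .
  then have "((\<lambda>u. \<sigma> (Y u)) has_derivative (\<lambda>h. (x' (h, 0), 0))) (at x0 within ball x0 r)"
    by (rule has_derivative_at_withinI)
  moreover have "(w has_derivative w') (at (\<sigma> (Y x0)) within (\<lambda>u. \<sigma> (Y u)) ` ball x0 r)"
    unfolding Yx0 \<sigma>x0 by (rule has_derivative_subset[OF w']) (use \<sigma>Y(1) in blast)
  ultimately have "(W has_derivative (\<lambda>h. w' (x' (h, 0), 0))) (at x0 within ball x0 r)"
    unfolding W_def by (rule has_derivative_in_compose)
  then have W': "(W has_derivative (\<lambda>h. w' (x' (h, 0), 0))) (at x0)"
    using r(1) by (simp add: at_within_open[OF _ open_ball])
  have Wx0: "W x0 = w z0" by (simp add: W_def Yx0 \<sigma>x0)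

  \<comment> \<open>\<open>w z\<close> and \<open>N (x z)\<close> are both multiples of
    \<open>G (x z)\<close>, and \<open>N (x z) \<bullet> p0 = - 1\<close> fixes the ratio.\<close>
  have normal: "w z + (w z \<bullet> p0) *\<^sub>R N (x z) = 0"
    if z: "z \<in> S" "z \<in> ball z0 \<eta>" "x z \<in> ball x0 \<eta>" for z
  proof -
    obtain c where c: "w z = c *\<^sub>R G (x z)" using kick[OF z(1,2)] by (auto simp: w_def x_def)
    have Y: "Y (x z) = x z" using Y_id z gx by blast
    have "\<sigma> (x z) \<in> ball z0 \<eta>" using z(3) \<sigma>b by blast
    then have "G (Y (x z)) \<bullet> p0 > 0"
      using Gp[of "\<sigma> (x z)" s0] e Y by (simp add: d\<sigma>) (simp add: \<sigma>_def)
    then show ?thesis by (simp add: c N_def Y)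
  qed
  have N0: "N x0 \<bullet> x' h = 0" for h using G0x' by (simp add: N_def Yx0 G0_def)

  \<comment> \<open>Symmetry of the derivative of the momentum jump\<close>
  have sym: "x' k \<bullet> w' h = x' h \<bullet> w' k" for h k
  proof (cases "w z0 = 0")
    case True
    have "(N \<longlongrightarrow> N x0) (nhds x0)"
    proof -
      have "(G \<longlongrightarrow> G x0) (nhds x0)" using G(1) by (rule isCont_tendsto_nhds)
      from filterlim_compose[OF this Yc] have GY: "((\<lambda>u. G (Y u)) \<longlongrightarrow> G x0) (nhds x0)" .
      show ?thesis unfolding N_def Yx0 using G(2) by (intro tendsto_intros GY) auto
    qed
    from filterlim_compose[OF this xc] have "((\<lambda>z. N (x z)) \<longlongrightarrow> N x0) (nhds z0)" .
    then have Nx: "((\<lambda>z. N (x z)) \<longlongrightarrow> N x0) (at z0 within S)"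
      by (rule tendsto_mono[rotated]) (simp add: at_within_def)
    have a: "((\<lambda>z. w z \<bullet> p0) has_derivative (\<lambda>h. w' h \<bullet> p0)) (at z0 within S)"
      using w' by (rule has_derivative_inner_left)
    \<comment> \<open>As \<open>w z0 = 0\<close>, the identity \<open>normal\<close> can be
      differentiated with \<open>N\<close> merely continuous. Then \<open>w' h\<close> is a multiple
      of \<open>N x0\<close>, and both sides of the symmetry vanish.\<close>
    have "w' h + (w' h \<bullet> p0) *\<^sub>R N x0 = 0" for h
    proof (rule unique)
      show "((\<lambda>z. w z + (w z \<bullet> p0) *\<^sub>R N (x z)) has_derivative (\<lambda>h. w' h + (w' h \<bullet> p0) *\<^sub>R N x0)) (at z0 within S)"
        by (intro has_derivative_add w' has_derivative_scaleR_vanishing a Nx) (simp add: True)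
    qed (use normal evS x0S in \<open>auto elim!: eventually_mono\<close>)
    then have "w' h = - (w' h \<bullet> p0) *\<^sub>R N x0" for h by (metis eq_neg_iff_add_eq_0 scaleR_minus_left)
    then have "x' k \<bullet> w' h = 0" for h k
      by (metis N0 inner_commute inner_scaleR_right mult_zero_right)
    then show ?thesis by simp
  next
    case False
    obtain c where c: "w z0 = c *\<^sub>R G0" using kick[OF zS z0b] by (auto simp: w_def T0 z0 G0_def)
    have wp: "w z0 \<bullet> p0 \<noteq> 0" using False c G(2) by (auto simp: G0_def)
    have "(W \<longlongrightarrow> W x0) (nhds x0)"
      by (rule isCont_tendsto_nhds[OF has_derivative_continuous[OF W']])
    then have "((\<lambda>u. W u \<bullet> p0) \<longlongrightarrow> W x0 \<bullet> p0) (nhds x0)" by (intro tendsto_intros)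
    then have "\<forall>\<^sub>F u in nhds x0. W u \<bullet> p0 \<noteq> 0"
      using wp Wx0 by (auto intro: tendsto_imp_eventually_ne)
    moreover have "\<forall>\<^sub>F u in nhds x0. u \<in> ball x0 r" using r(1) by (intro eventually_nhds_in_open) auto
    \<comment> \<open>Solving \<open>normal\<close> for \<open>N\<close> transfers differentiability
      from \<open>W\<close>. It applies off the interface as well because
      \<open>N (Y u) = N u\<close>.\<close>
    ultimately have NW: "\<forall>\<^sub>F u in nhds x0. (- 1 / (W u \<bullet> p0)) *\<^sub>R W u = N u"
    proof eventually_elim
      case (elim u)
      note s = \<sigma>Y[OF elim(2)]
      have "W u + (W u \<bullet> p0) *\<^sub>R N (Y u) = 0"
        using normal[OF s(1,2)] s(3) r(2)[OF elim(2)] by (simp add: W_def)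
      moreover have "N (Y u) = N u"
        using Y_id[of "Y u"] r(2)[OF elim(2)] gY[of u] by (simp add: N_def)
      ultimately have "W u = - ((W u \<bullet> p0) *\<^sub>R N u)" by (simp add: eq_neg_iff_add_eq_0)
      then have "(- 1 / (W u \<bullet> p0)) *\<^sub>R W u = (- 1 / (W u \<bullet> p0)) *\<^sub>R - ((W u \<bullet> p0) *\<^sub>R N u)" by simp
      also have "\<dots> = N u" using elim(1) by simp
      finally show ?case .
    qed
    have "\<exists>H. ((\<lambda>u. (- 1 / (W u \<bullet> p0)) *\<^sub>R W u) has_derivative H) (at x0)"
      by (rule exI) (rule derivative_intros W' | use wp Wx0 in simp)+
    then obtain H where H: "((\<lambda>u. (- 1 / (W u \<bullet> p0)) *\<^sub>R W u) has_derivative H) (at x0)" by blast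
    have H: "(N has_derivative H) (at x0)"
      using NW by (intro has_derivative_transform_eventually[OF H])
        (auto simp: eventually_nhds_conv_at)
    have symH: "H h \<bullet> k = H k \<bullet> h" for h k
    proof (rule has_gradient_derivative_symmetric[OF _ H])
      show "\<forall>\<^sub>F u in nhds x0. ((\<lambda>u. T (\<sigma> u)) has_derivative (\<lambda>h. N u \<bullet> h)) (at u)"
        using eventually_nhds_in_open[OF open_ball, of x0 x0 \<eta>] \<eta>
        by (auto elim!: eventually_mono intro: gradN)
    qed
    have "((\<lambda>z. N (x z)) has_derivative (\<lambda>h. H (x' h))) (at z0)"
      using has_derivative_compose[OF x', of N H] H by (simp add: xz0)
    then have Nx: "((\<lambda>z. N (x z)) has_derivative (\<lambda>h. H (x' h))) (at z0 within S)"
      by (rule has_derivative_at_withinI)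
    have a: "((\<lambda>z. w z \<bullet> p0) has_derivative (\<lambda>h. w' h \<bullet> p0)) (at z0 within S)"
      using w' by (rule has_derivative_inner_left)
    \<comment> \<open>Derivative of the identity \<open>normal\<close>. The last term is orthogonal
      to \<open>x' k\<close>, so \<open>x' k \<bullet> w' h\<close> is a multiple of the symmetric
      form \<open>H (x' h) \<bullet> x' k\<close>.\<close>
    have eq: "w' h + ((w z0 \<bullet> p0) *\<^sub>R H (x' h) + (w' h \<bullet> p0) *\<^sub>R N x0) = 0" for h
    proof (rule unique)
      show "((\<lambda>z. w z + (w z \<bullet> p0) *\<^sub>R N (x z)) has_derivative
          (\<lambda>h. w' h + ((w z0 \<bullet> p0) *\<^sub>R H (x' h) + (w' h \<bullet> p0) *\<^sub>R N x0))) (at z0 within S)"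
        using has_derivative_add[OF w' has_derivative_scaleR[OF a Nx]] by (simp add: xz0)
    qed (use normal evS x0S in \<open>auto elim!: eventually_mono\<close>)
    have "x' k \<bullet> w' h = - (w z0 \<bullet> p0) * (H (x' h) \<bullet> x' k)" for h k
    proof -
      have "x' k \<bullet> (w' h + ((w z0 \<bullet> p0) *\<^sub>R H (x' h) + (w' h \<bullet> p0) *\<^sub>R N x0)) = 0"
        unfolding eq by simp
      then show ?thesis using N0[of k] by (simp add: inner_add_right inner_commute)
    qed
    then show ?thesis using symH by metis
  qed

  \<comment> \<open>Cancellation of the hitting-time terms\<close>
  have F1: "fst (F' h) = x' h + (\<delta> - s0) *\<^sub>R P' h - T' h *\<^sub>R snd (F z0)" for h
  proof -
    have "((\<lambda>z. fst (F z) - (x z + (\<delta> - T z) *\<^sub>R snd (F z))) has_derivative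
        (\<lambda>h. fst (F' h) - (x' h + ((\<delta> - T z0) *\<^sub>R P' h + (0 - T' h) *\<^sub>R snd (F z0))))) (at z0 within S)"
      by (intro has_derivative_diff has_derivative_add has_derivative_scaleR has_derivative_fst F P'
          has_derivative_const has_derivative_at_withinI[OF x'] has_derivative_at_withinI[OF T'])
    then have "fst (F' h) - (x' h + ((\<delta> - T z0) *\<^sub>R P' h + (0 - T' h) *\<^sub>R snd (F z0))) = 0"
      by (rule unique) (use pos evS x0S in \<open>auto simp: x_def elim!: eventually_mono\<close>)
    then show ?thesis by (simp add: T0 algebra_simps)
  qed
  have F2: "snd (F z0) \<bullet> P' h = p0 \<bullet> snd h" for h
  proof -
    have "((\<lambda>z. snd (F z) \<bullet> snd (F z) - (snd z \<bullet> snd z + E)) has_derivative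
        (\<lambda>h. (snd (F z0) \<bullet> P' h + P' h \<bullet> snd (F z0)) - ((snd z0 \<bullet> snd h + snd h \<bullet> snd z0) + 0))) (at z0 within S)"
      by (intro has_derivative_diff has_derivative_add has_derivative_inner P'
          has_derivative_const has_derivative_snd has_derivative_ident)
    then have "(snd (F z0) \<bullet> P' h + P' h \<bullet> snd (F z0)) - ((snd z0 \<bullet> snd h + snd h \<bullet> snd z0) + 0) = 0"
      by (rule unique) (use energy evS x0S in \<open>auto elim!: eventually_mono\<close>)
    then show ?thesis by (simp add: z0 inner_commute)
  qed
  \<comment> \<open>The terms with \<open>\<delta> - s0\<close> cancel by symmetry of the inner
    product. \<open>F2\<close> rewrites the \<open>T'\<close> terms with the incident momentum, and
    these cancel against the ones contained in \<open>x'\<close>.\<close>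
  have "fst (F' h) \<bullet> snd (F' k) - snd (F' h) \<bullet> fst (F' k) = x' h \<bullet> P' k - x' k \<bullet> P' h
      - T' h * (p0 \<bullet> snd k) + T' k * (p0 \<bullet> snd h)"
    unfolding P'_def[symmetric] F1
    by (simp add: inner_add_left inner_add_right inner_diff_left inner_diff_right F2 F2[unfolded inner_commute[of "snd (F z0)"]] inner_commute)
  also have "x' h \<bullet> P' k - x' k \<bullet> P' h = x' h \<bullet> snd k - x' k \<bullet> snd h"
    using sym[of k h] by (simp add: w'_def inner_diff_right)
  also have "x' h \<bullet> snd k - x' k \<bullet> snd h - T' h * (p0 \<bullet> snd k) + T' k * (p0 \<bullet> snd h)
      = fst h \<bullet> snd k - snd h \<bullet> fst k"
    by (simp add: x'_def drift_def inner_add_left) (simp add: inner_commute)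
  finally show ?thesis .
qed

section \<open>The flow/impact map\<close>

lemma norm_normal_part: "norm n = 1 \<Longrightarrow> (norm (normal_part n p))\<^sup>2 = (p \<bullet> n)\<^sup>2"
  by (simp add: normal_part_def)

lemma impact_momentum_kick: "\<exists>c. impact_momentum n \<Delta>V p - p = c *\<^sub>R n"
proof -
  have "impact_momentum n \<Delta>V p - p = (if (norm (normal_part n p))\<^sup>2 / 2 < \<Delta>V then - (p \<bullet> n) - (p \<bullet> n)
      else sqrt ((norm (normal_part n p))\<^sup>2 - 2 * \<Delta>V) - p \<bullet> n) *\<^sub>R n"
    by (auto simp: impact_momentum_def Let_def normal_part_def vec_eq_iff algebra_simps)
  then show ?thesis by blast
qed

text \<open>The tangential part is kept, so only the square of the normal component counts:
  reflection preserves it, refraction lowers it by \<open>2 * \<Delta>V\<close>, with a nonnegative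
  radicand in that branch.\<close>

lemma impact_momentum_energy:
  assumes n: "norm n = 1"
  shows "impact_momentum n \<Delta>V p \<bullet> impact_momentum n \<Delta>V p
      = p \<bullet> p + (if (p \<bullet> n)\<^sup>2 / 2 < \<Delta>V then 0 else - 2 * \<Delta>V)"
proof -
  have nn: "n \<bullet> n = 1" using n by (simp add: dot_square_norm)
  have *: "(p - (p \<bullet> n) *\<^sub>R n + c *\<^sub>R n) \<bullet> (p - (p \<bullet> n) *\<^sub>R n + c *\<^sub>R n) = p \<bullet> p - (p \<bullet> n)\<^sup>2 + c\<^sup>2" for c
    by (simp add: inner_add_left inner_add_right inner_diff_left inner_diff_right nn
        inner_commute[of n p] power2_eq_square algebra_simps)
  show ?thesis
  proof (cases "(p \<bullet> n)\<^sup>2 / 2 < \<Delta>V")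
    case True
    have "impact_momentum n \<Delta>V p = p - (p \<bullet> n) *\<^sub>R n + (- (p \<bullet> n)) *\<^sub>R n"
      using True by (simp add: impact_momentum_def Let_def norm_normal_part[OF n]) (simp add: normal_part_def)
    then show ?thesis using True by (simp only: *) simp
  next
    case False
    have "impact_momentum n \<Delta>V p = p - (p \<bullet> n) *\<^sub>R n + sqrt ((p \<bullet> n)\<^sup>2 - 2 * \<Delta>V) *\<^sub>R n"
      using False by (simp add: impact_momentum_def Let_def norm_normal_part[OF n]) (simp add: normal_part_def)
    then show ?thesis using False by (simp only: *) simp
  qed
qed

lemma hit_time_eqI:
  assumes "0 \<le> t" "q + t *\<^sub>R p \<in> interfaces D M"
    and "\<And>s. 0 \<le> s \<Longrightarrow> s < t \<Longrightarrow> q + s *\<^sub>R p \<notin> interfaces D M"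
  shows "hit_time D M q p = t"
  unfolding hit_time_def using assms by (intro cInf_eq_minimum) (auto intro: leI)

lemma
  assumes "impact_within D M \<delta> q p"
  shows hit_time_nonneg: "0 \<le> hit_time D M q p"
    and hit_time_le: "hit_time D M q p \<le> \<delta>"
    and hit_pos_interface: "hit_pos D M q p \<in> interfaces D M"
    and before_hit_time: "0 \<le> s \<Longrightarrow> s < hit_time D M q p \<Longrightarrow> q + s *\<^sub>R p \<notin> interfaces D M"
proof -
  define H where "H = {s. 0 \<le> s \<and> q + s *\<^sub>R p \<in> interfaces D M}"
  have ht: "hit_time D M q p = Inf H" by (simp add: hit_time_def H_def)
  obtain s0 where s0: "s0 \<in> H" "s0 \<le> \<delta>" using assms unfolding impact_within_def H_def by auto
  have bdd: "bdd_below H" unfolding H_def by (intro bdd_belowI[of _ 0]) auto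
  have "closed ({0..} \<inter> (\<lambda>s. q + s *\<^sub>R p) -` interfaces D M)"
    by (intro closed_Int continuous_closed_vimage closed_interfaces continuous_intros)
  also have "{0..} \<inter> (\<lambda>s. q + s *\<^sub>R p) -` interfaces D M = H" unfolding H_def by auto
  finally have "Inf H \<in> H" using s0 bdd by (intro closed_contains_Inf) auto
  then show "0 \<le> hit_time D M q p" "hit_pos D M q p \<in> interfaces D M"
    unfolding hit_pos_def ht by (auto simp: H_def)
  show "hit_time D M q p \<le> \<delta>" unfolding ht using cInf_lower[OF s0(1) bdd] s0(2) by linarith
  show "q + s *\<^sub>R p \<notin> interfaces D M" if "0 \<le> s" "s < hit_time D M q p"
    using cInf_lower[OF _ bdd, of s] that unfolding ht by (auto simp: H_def)
qed

text \<open>Carries the side recorded in the initial state to the point of impact: before the first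
  hit the path is connected and avoids the interfaces. For a hit at time 0 the side of arrival is
  part of the state.\<close>

lemma arrives_from_hit_pos:
  assumes part: "region_partition D M" and i: "i \<in> {1..M}"
    and valid: "valid_state D M i q p" and imp: "impact_within D M \<delta> q p"
  shows "arrives_from (D i) (hit_pos D M q p) p"
    and "hit_time D M q p > 0 \<Longrightarrow> q \<in> D i"
proof -
  define t where "t = hit_time D M q p"
  have t0: "t \<ge> 0" unfolding t_def using imp by (rule hit_time_nonneg)
  have not0: "q \<notin> interfaces D M" if "t > 0"
    using before_hit_time[OF imp, of 0] that by (simp add: t_def)
  then show inD: "q \<in> D i" if "hit_time D M q p > 0"
    using valid that unfolding valid_state_def t_def by blast
  show "arrives_from (D i) (hit_pos D M q p) p"
  proof (cases "t > 0")
    case True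
    have "(\<lambda>s. q + s *\<^sub>R p) ` {0..<t} \<subseteq> closure (D i)"
    proof (rule connected_subset_region_closure[OF part i])
      show "connected ((\<lambda>s. q + s *\<^sub>R p) ` {0..<t})"
        by (intro connected_continuous_image continuous_intros) auto
      show "(\<lambda>s. q + s *\<^sub>R p) ` {0..<t} \<inter> interfaces D M = {}"
        using before_hit_time[OF imp] unfolding t_def by auto
      show "q \<in> (\<lambda>s. q + s *\<^sub>R p) ` {0..<t}" using True by (intro image_eqI[of _ _ 0]) auto
      show "q \<in> closure (D i)" using inD True closure_subset unfolding t_def by blast
    qed
    then have "q + (t - s) *\<^sub>R p \<in> closure (D i)" if "s \<in> {0<..<t}" for s
      using that by (auto simp: image_subset_iff)
    then show ?thesis
      unfolding arrives_from_def hit_pos_def t_def[symmetric]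
      using True by (intro exI[of _ t]) (auto simp: algebra_simps)
  next
    case False
    then have t: "t = 0" using t0 by simp
    then have "q \<in> interfaces D M" using hit_pos_interface[OF imp] by (simp add: hit_pos_def t_def)
    then have "arrives_from (D i) q p"
      using valid region_disjoint_interfaces[OF part i] unfolding valid_state_def by blast
    then show ?thesis using t by (simp add: hit_pos_def t_def)
  qed
qed

lemma drift_dist_le:
  fixes z z' :: "'a::real_normed_vector \<times> 'a"
  assumes "0 \<le> s"
  shows "dist (drift s z) (drift s z') \<le> (1 + s) * dist z z'"
proof -
  have le: "norm (fst w) \<le> norm w" "norm (snd w) \<le> norm w" for w :: "'a \<times> 'a"
    using norm_fst_le[of "fst w" "snd w"] norm_snd_le[of "snd w" "fst w"] by simp_all
  have "drift s z - drift s z' = fst (z - z') + s *\<^sub>R snd (z - z')" by (simp add: drift_def algebra_simps)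
  also have "norm \<dots> \<le> norm (fst (z - z')) + s * norm (snd (z - z'))"
    using assms norm_triangle_ineq[of "fst (z - z')" "s *\<^sub>R snd (z - z')"] by simp
  also have "\<dots> \<le> norm (z - z') + s * norm (z - z')"
    using assms by (intro add_mono mult_left_mono le)
  finally show ?thesis by (simp add: dist_norm algebra_simps)
qed

text \<open>A compact path has positive distance from \<open>C\<close>, and \<open>drift s\<close>
  is Lipschitz with constant at most \<open>1 + t\<close>. This keeps neighbouring states from
  hitting an interface before the time window.\<close>

lemma drift_avoids_closed:
  fixes z0 :: "'a::euclidean_space \<times> 'a"
  assumes "closed C" and off: "\<And>s. 0 \<le> s \<Longrightarrow> s \<le> t \<Longrightarrow> drift s z0 \<notin> C"
  obtains r where "r > 0" "\<And>z s. z \<in> ball z0 r \<Longrightarrow> 0 \<le> s \<Longrightarrow> s \<le> t \<Longrightarrow> drift s z \<notin> C"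
proof (cases "t < 0")
  case True
  then show thesis using that[of 1] by auto
next
  case False
  have "compact ((\<lambda>s. drift s z0) ` {0..t})"
    unfolding drift_def by (intro compact_continuous_image continuous_intros) auto
  moreover have "(\<lambda>s. drift s z0) ` {0..t} \<inter> C = {}" using off by auto
  ultimately obtain d where d: "d > 0" "\<And>x y. x \<in> (\<lambda>s. drift s z0) ` {0..t} \<Longrightarrow> y \<in> C \<Longrightarrow> d \<le> dist x y"
    using separate_compact_closed[OF _ \<open>closed C\<close>] by metis
  show thesis
  proof (rule that[of "d / (1 + t)"])
    show "d / (1 + t) > 0" using d False by simp
    fix z s assume z: "z \<in> ball z0 (d / (1 + t))" and s: "0 \<le> s" "s \<le> t"
    have "dist (drift s z0) (drift s z) \<le> (1 + s) * dist z0 z" by (rule drift_dist_le[OF s(1)])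
    also have "\<dots> \<le> (1 + t) * dist z0 z" using s by (intro mult_right_mono) auto
    also have "\<dots> < d" using z False by (simp add: pos_less_divide_eq mult.commute)
    finally show "drift s z \<notin> C" using d(2)[of "drift s z0" "drift s z"] s by force
  qed
qed

lemma phase_pair_vec [simp]: "phase_pair (phase_vec z) = z"
  by (simp add: phase_pair_def phase_vec_def)

lemma phase_vec_pair [simp]: "phase_vec (phase_pair x) = x"
  by (simp add: phase_pair_def phase_vec_def vec_eq_iff split: sum.split)

lemma linear_phase_vec: "linear phase_vec"
  by (rule linearI) (auto simp: phase_vec_def vec_eq_iff split: sum.split)

lemma linear_phase_pair: "linear phase_pair"
  by (rule linearI) (auto simp: phase_pair_def vec_eq_iff)

lemma has_jacobian_within_imp_has_derivative:
  assumes "has_jacobian_within F J z S"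
  shows "(F has_derivative (\<lambda>h. phase_pair (J *v phase_vec h))) (at z within S)"
proof -
  have "(phase_vec has_derivative phase_vec) (at z within S)"
    using linear_phase_vec linear_linear by (intro bounded_linear_imp_has_derivative) blast
  from has_derivative_in_compose[OF this assms[unfolded has_jacobian_within_def]]
  have "((\<lambda>z. phase_vec (F z)) has_derivative (\<lambda>h. J *v phase_vec h)) (at z within S)" by simp
  moreover have "bounded_linear phase_pair" using linear_phase_pair linear_linear by blast
  ultimately show ?thesis by (auto dest!: bounded_linear.has_derivative[of phase_pair])
qed

lemma inner_phase:
  fixes x y :: "real^('n::finite + 'n)"
  shows "x \<bullet> y = fst (phase_pair x) \<bullet> fst (phase_pair y) + snd (phase_pair x) \<bullet> snd (phase_pair y)"
proof -
  have "x \<bullet> y = (\<Sum>k\<in>UNIV <+> UNIV. x $ k * y $ k)" by (simp add: inner_vec_def)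
  also have "\<dots> = (\<Sum>a\<in>UNIV. x $ Inl a * y $ Inl a) + (\<Sum>a\<in>UNIV. x $ Inr a * y $ Inr a)"
    by (subst sum.Plus) (simp_all add: o_def)
  finally show ?thesis by (simp add: phase_pair_def inner_vec_def)
qed

lemma phase_pair_Omega:
  fixes y :: "real^('n::finite + 'n)"
  shows "phase_pair (Omega *v y) = (snd (phase_pair y), - fst (phase_pair y))"
proof -
  have sum: "(\<Sum>k\<in>UNIV. f k) = (\<Sum>a\<in>UNIV. f (Inl a)) + (\<Sum>a\<in>UNIV. f (Inr a))" for f :: "'n + 'n \<Rightarrow> real"
    using sum.Plus[of "UNIV :: 'n set" "UNIV :: 'n set" f] by (simp add: o_def)
  show ?thesis
    by (simp add: phase_pair_def matrix_vector_mult_def Omega_def sum mat_def vec_eq_iff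
        if_distrib[of "\<lambda>c. c * _"] if_distrib[of uminus] sum.delta cong: if_cong)
qed

lemma symplectic_matrixI:
  fixes J :: "real^('n::finite + 'n)^('n::finite + 'n)"
  assumes "\<And>h k. fst (phase_pair (J *v phase_vec h)) \<bullet> snd (phase_pair (J *v phase_vec k))
      - snd (phase_pair (J *v phase_vec h)) \<bullet> fst (phase_pair (J *v phase_vec k)) = fst h \<bullet> snd k - snd h \<bullet> fst k"
  shows "transpose J ** Omega ** J = Omega"
proof -
  have Om: "x \<bullet> (Omega *v y) = fst (phase_pair x) \<bullet> snd (phase_pair y) - snd (phase_pair x) \<bullet> fst (phase_pair y)"
    for x y :: "real^('n + 'n)"
    by (simp add: inner_phase[of x] phase_pair_Omega)
  have "x \<bullet> ((transpose J ** Omega ** J) *v y) = x \<bullet> (Omega *v y)" for x y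
  proof -
    have "x \<bullet> (transpose J *v u) = (J *v x) \<bullet> u" for u
      by (metis dot_lmul_matrix inner_commute transpose_matrix_vector)
    then have "x \<bullet> ((transpose J ** Omega ** J) *v y) = (J *v x) \<bullet> (Omega *v (J *v y))"
      by (simp add: matrix_vector_mul_assoc[symmetric] del: transpose_matrix_vector)
    also have "\<dots> = x \<bullet> (Omega *v y)"
      using assms[of "phase_pair x" "phase_pair y"] by (simp add: Om)
    finally show ?thesis .
  qed
  then show ?thesis unfolding matrix_eq using vector_eq_ldot by blast
qed

theorem theorem3p1:
  fixes D :: "nat \<Rightarrow> (real^'n) set" and V :: "nat \<Rightarrow> real" and M i :: nat and \<delta> :: real
    and q p :: "real^'n" and J :: "real^('n::finite + 'n)^('n::finite + 'n)"
  assumes "region_partition D M"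
    and "\<forall>k\<in>{1..M}. \<forall>l\<in>{1..M}. C1_hypersurface (interface D k l)"
    and "\<delta> > 0"
    and "i \<in> {1..M}"
    and "valid_state D M i q p"
    and "impact_within D M \<delta> q p"
    and "single_impact D M V i \<delta> q p"
    and "condition1 D M V i \<delta> q p"
    and "condition2 D M V i \<delta> q p"
    and "has_jacobian_within (phi2 D M V i \<delta>) J (q, p) (impact_states D M i \<delta>)"
  shows "transpose J ** Omega ** J = Omega"
proof (rule symplectic_matrixI)
  note part = assms(1) and C1 = assms(2) and i = assms(4) and imp = assms(6)
  define S where "S = impact_states D M i \<delta>"
  define s0 where "s0 = hit_time D M q p"
  define x0 where "x0 = hit_pos D M q p"
  define z0 where "z0 = (q, p)"
  have x0: "x0 = drift s0 z0" by (simp add: x0_def hit_pos_def s0_def drift_def z0_def)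
  have S_iff: "z \<in> S \<longleftrightarrow> valid_state D M i (fst z) (snd z) \<and> impact_within D M \<delta> (fst z) (snd z)" for z
    unfolding S_def impact_states_def by (auto simp: case_prod_unfold)
  have z0S: "z0 \<in> S" unfolding S_iff using assms(5,6) by (simp add: z0_def)
  have s0: "0 \<le> s0" "s0 \<le> \<delta>" using hit_time_nonneg[OF imp] hit_time_le[OF imp] by (auto simp: s0_def)
  have x0I: "x0 \<in> interfaces D M" unfolding x0_def by (rule hit_pos_interface[OF imp])
  \<comment> \<open>Conditions 1 and 2 speak of the trajectory. A step of length exactly
    \<open>s0\<close> leaves no drift after the impact, so it ends at \<open>x0\<close>.\<close>
  have "impact_within D M s0 q p"
    unfolding impact_within_def using s0 x0I by (intro bexI[of _ s0]) (auto simp: x0 drift_def z0_def)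
  then have phi_s0: "fst (phi2 D M V i s0 (q, p)) = x0" by (simp add: phi2_def s0_def x0_def)
  have s0I: "s0 \<in> {0..\<delta>}" using s0 by simp
  have arr: "arrives_from (D i) x0 p" and inD: "s0 > 0 \<Longrightarrow> q \<in> D i"
    unfolding x0_def s0_def using arrives_from_hit_pos[OF part i assms(5) imp] by blast+

  \<comment> \<open>The interface near the point of impact\<close>
  have uniq: "{k, l} = {k', l'}" if "k \<in> {1..M}" "l \<in> {1..M}" "k' \<in> {1..M}" "l' \<in> {1..M}"
    "x0 \<in> interface D k l \<inter> interface D k' l'" for k l k' l'
    using assms(8) s0I that unfolding condition1_def phi_s0[symmetric] by blast
  have trans: "p \<notin> tangent_space (interface D k l) x0"
    if "k \<in> {1..M}" "l \<in> {1..M}" "x0 \<in> interface D k l" for k l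
    using assms(9) s0I that s0_def unfolding condition2_def phi_s0[symmetric] by blast
  obtain j r g G where j: "j \<in> {1..M}" and r: "r > 0"
    and g': "\<And>y. y \<in> ball x0 r \<Longrightarrow> (g has_derivative (\<lambda>h. G y \<bullet> h)) (at y)"
    and Gc: "continuous_on (ball x0 r) G" and Gp: "G x0 \<bullet> p > 0" and gx0: "g x0 = (0::real)"
    and gI: "\<And>y. y \<in> ball x0 r \<Longrightarrow> y \<in> interfaces D M \<longleftrightarrow> g y = 0"
    and gcl: "\<And>y. y \<in> ball x0 r \<Longrightarrow> g y < 0 \<Longrightarrow> y \<in> closure (D i)"
    and gD: "\<And>y. y \<in> ball x0 r \<Longrightarrow> y \<in> D i \<Longrightarrow> g y < 0"
    and beyond: "\<And>y. y \<in> ball x0 r \<Longrightarrow> g y = 0 \<Longrightarrow> region_beyond D M i y = j"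
    and normal: "\<And>y. y \<in> ball x0 r \<Longrightarrow> g y = 0 \<Longrightarrow> unit_normal D i j y = (1 / norm (G y)) *\<^sub>R G y"
    and Gnz: "\<And>y. y \<in> ball x0 r \<Longrightarrow> G y \<noteq> 0"
  proof (rule interface_local_structure[OF part C1 i x0I _ arr], goal_cases)
    case 1
    from 1(2-) show ?case by (rule uniq)
  next
    case 2
    from 2(2-) show ?case by (rule trans)
  next
    case prems: (3 j r g G)
    show ?case by (rule prems(1)[of j r g G]) (fact prems)+
  qed
  \<comment> \<open>\<open>s0 / 2\<close> keeps the hitting times of nearby states positive; for an
    impact at time 0 the cap \<open>\<delta>\<close> keeps them within the step.\<close>
  define e0 where "e0 = (if s0 > 0 then s0 / 2 else \<delta>)"
  have e0: "e0 > 0" using s0 assms(3) by (simp add: e0_def)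
  have x0b: "x0 \<in> ball x0 r" using r by simp
  obtain e \<eta> T where e: "0 < e" "e \<le> e0" and \<eta>: "0 < \<eta>" and T0: "T z0 = s0"
    and inb: "\<And>z s. z \<in> ball z0 \<eta> \<Longrightarrow> \<bar>s - s0\<bar> \<le> e \<Longrightarrow> drift s z \<in> ball x0 r"
    and Gpos: "\<And>z s. z \<in> ball z0 \<eta> \<Longrightarrow> \<bar>s - s0\<bar> \<le> e \<Longrightarrow> G (drift s z) \<bullet> snd z > 0"
    and Te: "\<And>z. z \<in> ball z0 \<eta> \<Longrightarrow> \<bar>T z - s0\<bar> < e"
    and neg: "\<And>z s. z \<in> ball z0 \<eta> \<Longrightarrow> \<bar>s - s0\<bar> \<le> e \<Longrightarrow> g (drift s z) < 0 \<longleftrightarrow> s < T z"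
    and zero: "\<And>z s. z \<in> ball z0 \<eta> \<Longrightarrow> \<bar>s - s0\<bar> \<le> e \<Longrightarrow> g (drift s z) = 0 \<longleftrightarrow> s = T z"
    and dT: "\<And>z. z \<in> ball z0 \<eta> \<Longrightarrow> (T has_derivative
        (\<lambda>h. - (G (drift (T z) z) \<bullet> drift (T z) h) / (G (drift (T z) z) \<bullet> snd z))) (at z)"
    by (rule implicit_hitting_time[of "ball x0 r" g G s0 z0 e0, OF open_ball g' Gc])
       (use x0b gx0 Gp e0 in \<open>simp_all add: x0[symmetric]\<close>, simp add: z0_def)
  have es0: "s0 - e > 0" if "s0 > 0" using e(2) that by (simp add: e0_def)
  have e\<delta>: "e \<le> \<delta>" if "s0 = 0" using e(2) that by (simp add: e0_def)

  \<comment> \<open>Stability of the first hit, the region and the branch\<close>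
  have "drift s z0 \<notin> interfaces D M" if "0 \<le> s" "s \<le> s0 - e" for s
    using before_hit_time[OF imp that(1)] that(2) e(1) by (simp add: s0_def drift_def z0_def)
  then obtain r1 where r1: "r1 > 0"
    "\<And>z s. z \<in> ball z0 r1 \<Longrightarrow> 0 \<le> s \<Longrightarrow> s \<le> s0 - e \<Longrightarrow> drift s z \<notin> interfaces D M"
    using drift_avoids_closed[OF closed_interfaces, of "s0 - e" z0] by blast
  have "\<exists>r2>0. s0 > 0 \<longrightarrow> (\<forall>z\<in>ball z0 r2. fst z \<in> D i)"
  proof (cases "s0 > 0")
    case True
    have "open (fst -` D i :: ((real^'n) \<times> (real^'n)) set)"
      using part i unfolding region_partition_def by (intro open_vimage) (auto intro: continuous_intros)
    moreover have "z0 \<in> fst -` D i" using inD[OF True] by (simp add: z0_def)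
    ultimately obtain r2 where "r2 > 0" "ball z0 r2 \<subseteq> fst -` D i"
      unfolding open_contains_ball by blast
    then show ?thesis by (intro exI[of _ r2]) blast
  qed (auto intro: exI[of _ 1])
  then obtain r2 where r2: "r2 > 0" "\<And>z. s0 > 0 \<Longrightarrow> z \<in> ball z0 r2 \<Longrightarrow> fst z \<in> D i" by blast

  define n where "n y = (1 / norm (G y)) *\<^sub>R G y" for y
  define dV where "dV = V j - V i"
  \<comment> \<open>Normal kinetic energy at the hit. Condition 2 separates it from
    \<open>dV\<close>, so by continuity nearby states are all reflected or all refracted.\<close>
  define a where "a z = (snd z \<bullet> n (drift (T z) z))\<^sup>2 / 2" for z
  have norm_n: "norm (n y) = 1" if "y \<in> ball x0 r" for y using Gnz[OF that] by (simp add: n_def)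
  have z0b: "z0 \<in> ball z0 \<eta>" using \<eta> by simp
  have Gcont: "isCont G x0" using Gc x0b by (simp add: continuous_on_eq_continuous_at)
  have bdd_a: "\<exists>r3>0. \<forall>z\<in>ball z0 r3. a z < dV \<longleftrightarrow> a z0 < dV"
  proof -
    have "isCont (\<lambda>z. drift (T z) z) z0"
      unfolding drift_def by (intro continuous_intros has_derivative_continuous[OF dT[OF z0b]])
    moreover have "drift (T z0) z0 = x0" by (simp add: T0 x0)
    ultimately have "isCont (\<lambda>z. G (drift (T z) z)) z0" using Gcont by (intro isCont_o2[of z0 "\<lambda>z. drift (T z) z" G]) auto
    then have "isCont a z0"
      unfolding a_def n_def using Gnz[OF x0b] x0 T0 by (intro continuous_intros) auto
    note lim = isCont_tendsto_nhds[OF this]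
    have "a z0 \<noteq> dV"
    proof -
      have "region_beyond D M i x0 = j" "unit_normal D i j x0 = n x0"
        using beyond[OF x0b gx0] normal[OF x0b gx0] by (auto simp: n_def)
      then have "hit_normal D M i q p = n x0" "hit_jump D M V i q p = dV"
        by (simp_all add: hit_normal_def hit_jump_def x0_def[symmetric] dV_def)
      then show ?thesis
        using assms(9) imp norm_normal_part[OF norm_n[OF x0b], of p]
        unfolding condition2_def a_def by (simp add: T0 x0[symmetric]) (simp add: z0_def)
    qed
    then have "\<forall>\<^sub>F z in nhds z0. a z < dV \<longleftrightarrow> a z0 < dV"
    proof (cases "a z0 < dV")
      case True
      show ?thesis using order_tendstoD(2)[OF lim True] by eventually_elim (use True in simp)
    next
      case False
      then have "a z0 > dV" using \<open>a z0 \<noteq> dV\<close> by simp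
      from order_tendstoD(1)[OF lim this] show ?thesis by eventually_elim (use False in simp)
    qed
    then show ?thesis unfolding eventually_nhds_metric by (auto simp: dist_commute)
  qed
  then obtain r3 where r3: "r3 > 0" "\<And>z. z \<in> ball z0 r3 \<Longrightarrow> a z < dV \<longleftrightarrow> a z0 < dV" by blast

  define \<eta>' where "\<eta>' = min (min \<eta> r) (min r1 (min r2 r3))"
  have \<eta>': "\<eta>' > 0" using \<eta> r r1 r2 r3 by (simp add: \<eta>'_def)
  have sub: "z \<in> ball z0 \<eta>" "z \<in> ball z0 r1" "z \<in> ball z0 r2" "z \<in> ball z0 r3" "z \<in> ball z0 r"
    if "z \<in> ball z0 \<eta>'" for z using that by (auto simp: \<eta>'_def)
  have xb: "drift (T z) z \<in> ball x0 r" "g (drift (T z) z) = 0" if "z \<in> ball z0 \<eta>'" for z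
    using inb[OF sub(1)[OF that], of "T z"] zero[OF sub(1)[OF that], of "T z"] Te[OF sub(1)[OF that]]
    by auto
  have before: "drift s z \<notin> interfaces D M" if z: "z \<in> ball z0 \<eta>'" and s: "0 \<le> s" "s < T z" for z s
  proof (cases "s \<le> s0 - e")
    case True
    then show ?thesis using r1(2)[OF sub(2)[OF z] s(1)] by blast
  next
    case False
    then have "\<bar>s - s0\<bar> \<le> e" using s Te[OF sub(1)[OF z]] by auto
    then show ?thesis using gI[OF inb[OF sub(1)[OF z]]] zero[OF sub(1)[OF z]] s by auto
  qed
  have hit: "hit_time D M (fst z) (snd z) = T z" if z: "z \<in> ball z0 \<eta>'" and T: "T z \<ge> 0" for z
    using T before[OF z] gI[OF xb(1)[OF z]] xb(2)[OF z]
    by (intro hit_time_eqI) (auto simp: drift_def)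
  have near_q: "fst z \<in> ball x0 r" if "s0 = 0" "z \<in> ball z0 \<eta>'" for z
  proof -
    have "dist (drift 0 z0) (drift 0 z) \<le> dist z0 z" using drift_dist_le[of 0 z0 z] by simp
    then show ?thesis using sub(5)[OF that(2)] that(1) by (simp add: x0 drift_def)
  qed
  \<comment> \<open>For \<open>s0 = 0\<close> a nearby valid state starts in \<open>D i\<close> or
    on the interface, so \<open>g \<le> 0\<close> at its position and its hit is not in the past.
    This identifies \<open>T\<close> with the hitting time on \<open>S\<close>.\<close>
  have T_pos: "T z \<ge> 0" if z: "z \<in> S" "z \<in> ball z0 \<eta>'" for z
  proof (cases "s0 > 0")
    case True
    then show ?thesis using Te[OF sub(1)[OF z(2)]] es0 by auto
  next
    case False
    then have s: "s0 = 0" using s0 by simp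
    note q = near_q[OF s z(2)]
    have d0: "drift 0 z = fst z" by (simp add: drift_def)
    have "fst z \<in> D i \<or> fst z \<in> interfaces D M" using z(1) unfolding S_iff valid_state_def by blast
    then have "g (fst z) \<le> 0" using gD[OF q] gI[OF q] by auto
    then show ?thesis
      using neg[OF sub(1)[OF z(2)], of 0] zero[OF sub(1)[OF z(2)], of 0] e(1) s d0 by auto
  qed
  have inS: "z \<in> S" if z: "z \<in> ball z0 \<eta>'" and T: "0 \<le> T z" "T z \<le> \<delta>" and v: "valid_state D M i (fst z) (snd z)" for z
    unfolding S_iff impact_within_def
    using v T gI[OF xb(1)[OF z]] xb(2)[OF z] by (auto simp: drift_def intro!: bexI[of _ "T z"])
  have hit_pos: "hit_pos D M (fst z) (snd z) = drift (T z) z" if "z \<in> S" "z \<in> ball z0 \<eta>'" for z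
    by (simp add: hit_pos_def hit[OF that(2) T_pos[OF that]] drift_def)
  have bounce: "bounce D M V i (fst z) (snd z) = impact_momentum (n (drift (T z) z)) dV (snd z)"
    if z: "z \<in> S" "z \<in> ball z0 \<eta>'" for z
    using beyond[OF xb[OF z(2)]] normal[OF xb[OF z(2)]]
    by (simp add: bounce_def hit_normal_def hit_jump_def hit_pos[OF z] n_def dV_def Let_def)
  have phi: "phi2 D M V i \<delta> z = (drift (T z) z + (\<delta> - T z) *\<^sub>R impact_momentum (n (drift (T z) z)) dV (snd z),
      impact_momentum (n (drift (T z) z)) dV (snd z))"
    if z: "z \<in> S" "z \<in> ball z0 \<eta>'" for z
    using z(1) hit[OF z(2) T_pos[OF z]] unfolding S_iff phi2_def
    by (simp add: case_prod_unfold hit_pos[OF z] bounce[OF z])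

  \<comment> \<open>Directions accessible through impact states\<close>
  define sg :: real where "sg = (if s0 > 0 then 1 else - 1)"
  \<comment> \<open>For \<open>s0 > 0\<close>, \<open>l h > 0\<close> makes \<open>T\<close>
    decrease along \<open>h\<close>, so the hit stays within the step even if
    \<open>s0 = \<delta>\<close>. For \<open>s0 = 0\<close> the sign is reversed: the position has
    to move to the side of arrival.\<close>
  define l where "l h = sg * (G x0 \<bullet> drift s0 h)" for h
  have l: "linear l"
    unfolding l_def drift_def
    by (rule linearI) (auto simp: algebra_simps inner_add_right)
  have lb: "l (sg *\<^sub>R p, 0) > 0" using Gp by (simp add: l_def drift_def sg_def)
  have cone: "\<exists>t\<in>{0<..<\<epsilon>}. \<exists>x\<in>S. norm (x - z0 - t *\<^sub>R h) \<le> \<epsilon> * t" if h: "l h > 0" and \<epsilon>: "\<epsilon> > 0" for h \<epsilon>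
  proof -
    define \<rho> where "\<rho> = min \<epsilon> (\<eta>' / (norm h + \<epsilon> + 1))"
    have nh: "norm h + \<epsilon> + 1 > 0" using \<epsilon> norm_ge_zero[of h] by linarith
    have \<rho>: "\<rho> > 0" using \<epsilon> \<eta>' nh by (simp add: \<rho>_def)
    have close: "x \<in> ball z0 \<eta>'" if t: "0 < t" "t < \<rho>" and x: "norm (x - z0 - t *\<^sub>R h) \<le> \<epsilon> * t" for t x
    proof -
      have "norm (x - z0) \<le> \<epsilon> * t + t * norm h"
        using norm_triangle_ineq[of "x - z0 - t *\<^sub>R h" "t *\<^sub>R h"] x t by simp
      also have "\<dots> \<le> t * (norm h + \<epsilon> + 1)" using t by (simp add: algebra_simps)
      also have "\<dots> < \<eta>'" using t nh by (simp add: \<rho>_def pos_less_divide_eq)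
      finally show ?thesis by (simp add: dist_norm norm_minus_commute)
    qed
    show ?thesis
    proof (cases "s0 > 0")
      case True
      have "((\<lambda>t. z0 + t *\<^sub>R h) has_derivative (\<lambda>t. t *\<^sub>R h)) (at (0::real))"
        by (auto intro!: derivative_eq_intros)
      moreover have "(T has_derivative (\<lambda>h. - (G x0 \<bullet> drift s0 h) / (G x0 \<bullet> p))) (at (z0 + 0 *\<^sub>R h))"
        using dT[OF z0b] unfolding T0 x0[symmetric] by (simp add: z0_def)
      ultimately have "((\<lambda>t. T (z0 + t *\<^sub>R h)) has_derivative
          (\<lambda>t. - (G x0 \<bullet> drift s0 (t *\<^sub>R h)) / (G x0 \<bullet> p))) (at 0)"
        by (rule has_derivative_compose)
      then have "DERIV (\<lambda>t. T (z0 + t *\<^sub>R h)) 0 :> - (G x0 \<bullet> drift s0 h) / (G x0 \<bullet> p)"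
        by (rule has_derivative_imp_has_field_derivative) (simp add: drift_def inner_add_right algebra_simps)
      moreover have "- (G x0 \<bullet> drift s0 h) / (G x0 \<bullet> p) < 0"
        using h True Gp by (simp add: l_def sg_def)
      ultimately have "\<exists>d>0. \<forall>t>0. t < d \<longrightarrow> T (z0 + 0 *\<^sub>R h) > T (z0 + (0 + t) *\<^sub>R h)"
        by (rule DERIV_neg_dec_right)
      then obtain d where d: "d > 0" "\<And>t. 0 < t \<Longrightarrow> t < d \<Longrightarrow> T (z0 + t *\<^sub>R h) < T z0" by auto
      define t where "t = min d \<rho> / 2"
      have t: "0 < t" "t < d" "t < \<rho>" using d(1) \<rho> by (auto simp: t_def)
      have b: "z0 + t *\<^sub>R h \<in> ball z0 \<eta>'" using close[OF t(1,3), of "z0 + t *\<^sub>R h"] t \<epsilon> by simp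
      have "T (z0 + t *\<^sub>R h) \<ge> 0" using Te[OF sub(1)[OF b]] es0[OF True] by auto
      moreover have "T (z0 + t *\<^sub>R h) \<le> \<delta>" using d(2)[OF t(1,2)] T0 s0 by simp
      moreover have "valid_state D M i (fst (z0 + t *\<^sub>R h)) (snd (z0 + t *\<^sub>R h))"
        unfolding valid_state_def using r2(2)[OF True sub(3)[OF b]] by blast
      ultimately have "z0 + t *\<^sub>R h \<in> S" using inS[OF b] by blast
      then show ?thesis using t \<epsilon> by (intro bexI[of _ t] bexI[of _ "z0 + t *\<^sub>R h"]) (auto simp: \<rho>_def)
    next
      case False
      then have s: "s0 = 0" using s0 by simp
      have xq: "x0 = q" by (simp add: x0 s drift_def z0_def)
      have "((\<lambda>t. q + t *\<^sub>R fst h) has_derivative (\<lambda>t. t *\<^sub>R fst h)) (at (0::real))"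
        by (auto intro!: derivative_eq_intros)
      moreover have "(g has_derivative (\<lambda>h. G x0 \<bullet> h)) (at (q + 0 *\<^sub>R fst h))"
        using g'[OF x0b] by (simp add: xq)
      ultimately have "((\<lambda>t. g (q + t *\<^sub>R fst h)) has_derivative (\<lambda>t. G x0 \<bullet> (t *\<^sub>R fst h))) (at 0)"
        by (rule has_derivative_compose)
      then have "DERIV (\<lambda>t. g (q + t *\<^sub>R fst h)) 0 :> G x0 \<bullet> fst h"
        by (rule has_derivative_imp_has_field_derivative) simp
      moreover have "G x0 \<bullet> fst h < 0" using h False s by (simp add: l_def sg_def drift_def)
      ultimately have "\<exists>d>0. \<forall>t>0. t < d \<longrightarrow> g (q + 0 *\<^sub>R fst h) > g (q + (0 + t) *\<^sub>R fst h)"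
        by (rule DERIV_neg_dec_right)
      then obtain d where d: "d > 0" "\<And>t. 0 < t \<Longrightarrow> t < d \<Longrightarrow> g (q + t *\<^sub>R fst h) < g q" by auto
      define t where "t = min d \<rho> / 2"
      have t: "0 < t" "t < d" "t < \<rho>" using d(1) \<rho> by (auto simp: t_def)
      have b: "z0 + t *\<^sub>R h \<in> ball z0 \<eta>'" using close[OF t(1,3), of "z0 + t *\<^sub>R h"] t \<epsilon> by simp
      have "fst (z0 + t *\<^sub>R h) = q + t *\<^sub>R fst h" by (simp add: z0_def)
      then have "q + t *\<^sub>R fst h \<in> closure (D i)"
        using gcl[OF near_q[OF s b]] d(2)[OF t(1,2)] gx0 xq by simp
      \<comment> \<open>The shifted position is only known to be in \<open>closure (D i)\<close>; a
        correction below \<open>\<epsilon> * t\<close>, which the contingent cone tolerates, moves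
        it into \<open>D i\<close>.\<close>
      then obtain q' where q': "q' \<in> D i" "dist q' (q + t *\<^sub>R fst h) < \<epsilon> * t"
        using \<epsilon> t unfolding closure_approachable by (meson mult_pos_pos)
      define z where "z = (q', p + t *\<^sub>R snd h)"
      have "z - z0 - t *\<^sub>R h = (q' - (q + t *\<^sub>R fst h), 0)"
        by (simp add: z_def z0_def prod_eq_iff algebra_simps)
      then have zn: "norm (z - z0 - t *\<^sub>R h) \<le> \<epsilon> * t" using q'(2) by (simp add: norm_Pair dist_norm)
      note b = close[OF t(1,3) zn]
      have "g (fst z) < 0" using gD[OF near_q[OF s b]] q'(1) by (simp add: z_def)
      then have "T z > 0" using neg[OF sub(1)[OF b], of 0] s e(1) by (simp add: drift_def)
      moreover have "T z \<le> \<delta>" using Te[OF sub(1)[OF b]] e\<delta>[OF s] s by auto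
      moreover have "valid_state D M i (fst z) (snd z)" unfolding valid_state_def using q'(1) by (simp add: z_def)
      ultimately have "z \<in> S" using inS[OF b] by simp
      then show ?thesis using t zn by (intro bexI[of _ t] bexI[of _ z]) (auto simp: \<rho>_def)
    qed
  qed

  define E where "E = (if a z0 < dV then 0 else - 2 * dV)"
  define F' where "F' h = phase_pair (J *v phase_vec h)" for h
  fix h k
  have "fst (F' h) \<bullet> snd (F' k) - snd (F' h) \<bullet> fst (F' k) = fst h \<bullet> snd k - snd h \<bullet> fst k"
  proof (rule impact_map_symplectic[where F = "phi2 D M V i \<delta>" and S = S and G = G and g = g and T = T
        and \<eta> = \<eta>' and e = e and \<delta> = \<delta> and E = E and l = l and b = "(sg *\<^sub>R p, 0)"
        and ?q0.0 = q and ?p0.0 = p and ?s0.0 = s0, folded z0_def x0])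
    show "(phi2 D M V i \<delta> has_derivative F') (at z0 within S)"
      unfolding F'_def z0_def S_def using assms(10) by (rule has_jacobian_within_imp_has_derivative)
    show "(y - s0 *\<^sub>R p, p) \<in> S" if y: "y \<in> ball x0 \<eta>'" "g y = 0" for y
    proof -
      define z where "z = (y - s0 *\<^sub>R p, p)"
      have "z - z0 = (y - x0, 0)" by (simp add: z_def z0_def x0 drift_def algebra_simps)
      then have "norm (z - z0) = norm (y - x0)" by (simp add: norm_Pair)
      then have b: "z \<in> ball z0 \<eta>'" using y(1) by (simp add: dist_norm norm_minus_commute)
      have "drift s0 z = y" by (simp add: drift_def z_def)
      then have T: "T z = s0" using zero[OF sub(1)[OF b], of s0] y(2) e(1) by simp
      have "valid_state D M i (fst z) (snd z)"
      proof (cases "s0 > 0")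
        case True
        then show ?thesis unfolding valid_state_def using r2(2)[OF True sub(3)[OF b]] by blast
      next
        case False
        then have s: "s0 = 0" using s0 by simp
        have y_eq: "fst z = y" "snd z = p" by (simp_all add: z_def s)
        have "y \<in> interfaces D M" using gI[OF near_q[OF s b]] y(2) y_eq by simp
        \<comment> \<open>This state starts on the interface, so its validity rests on the side of
          arrival: slightly earlier positions have \<open>g < 0\<close>.\<close>
        moreover have "y - u *\<^sub>R p \<in> closure (D i)" if u: "u \<in> {0<..<e}" for u
        proof -
          have "drift (- u) z = y - u *\<^sub>R p" by (simp add: drift_def y_eq)
          then show ?thesis
            using gcl[OF inb[OF sub(1)[OF b], of "- u"]] neg[OF sub(1)[OF b], of "- u"] u T s by auto
        qed
        ultimately show ?thesis unfolding valid_state_def arrives_from_def y_eq using e(1) by blast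
      qed
      then show ?thesis using inS[OF b] T s0 by (simp add: z_def)
    qed
    fix z assume z: "z \<in> S" "z \<in> ball z0 \<eta>'"
    show "fst (phi2 D M V i \<delta> z) = drift (T z) z + (\<delta> - T z) *\<^sub>R snd (phi2 D M V i \<delta> z)"
      by (simp add: phi[OF z])
    obtain c where "impact_momentum (n (drift (T z) z)) dV (snd z) - snd z = c *\<^sub>R n (drift (T z) z)"
      using impact_momentum_kick by blast
    then show "\<exists>c. snd (phi2 D M V i \<delta> z) - snd z = c *\<^sub>R G (drift (T z) z)"
      by (auto simp: phi[OF z] n_def)
    show "snd (phi2 D M V i \<delta> z) \<bullet> snd (phi2 D M V i \<delta> z) = snd z \<bullet> snd z + E"
      using impact_momentum_energy[OF norm_n[OF xb(1)[OF z(2)]], of dV "snd z"] r3(2)[OF sub(4)[OF z(2)]]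
      by (simp add: phi[OF z] E_def a_def)
  qed (use z0S Gcont Gp \<eta>' T0 e l lb cone Te Gpos zero dT sub in blast)+
  then show "fst (phase_pair (J *v phase_vec h)) \<bullet> snd (phase_pair (J *v phase_vec k))
      - snd (phase_pair (J *v phase_vec h)) \<bullet> fst (phase_pair (J *v phase_vec k)) = fst h \<bullet> snd k - snd h \<bullet> fst k"
    by (simp add: F'_def)
qed

end
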